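(* Let $l$ be a field and $G$ a finite group acting on $S:=l[[x_1,\ldots,x_d]]$ by ring automorphisms, with $|G|$ not divisible by $\operatorname{char} l$. Let $G$ act on the residue field $l$ of $S$ in the induced way and put $k:=l^G$. Then there exist a group homomorphism $\phi\colon G\to GL_d(l)\rtimes\operatorname{Gal}(l/k)$ and a ring automorphism $\theta\colon S\to S$ such that for all $g\in G$ \[g\circ\theta=\theta\circ\phi(g)\] as maps $S\to S$. In particular, there is a ring isomorphism $S^G\cong S^{\phi(G)}$.
   Context: In $GL_d(l)\rtimes\operatorname{Gal}(l/k)$ the Galois group acts on matrices entrywise, so $(A,\sigma)(B,\tau)=(A\sigma(B),\sigma\tau)$. This group acts on $S$ by continuous $k$-algebra automorphisms determined by $(A,\sigma)(\lambda)=\sigma(\lambda)$ for $\lambda\in l$ and $(A,\sigma)(x_j)=a_{1j}x_1+\cdots+a_{dj}x_d$ for $A=[a_{ij}]$. If $\operatorname{char} l=0$ the divisibility condition is vacuous. The $G$-action on $S$ is not assumed to be $l$-linear. *)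

theory Defs
  imports
    "HOL-Library.Multiset"
    "HOL-Algebra.Group_Action"
    "HOL-Algebra.QuotRing"
    "Jordan_Normal_Form.Matrix"
begin

text \<open>
  The ring of formal power series in the variables \<open>x\<^sub>0, \<dots>, x\<^sub>d\<^sub>-\<^sub>1\<close> (so \<open>d = 0\<close> is allowed and
  indices start at 0, as in \<^typ>\<open>'a mat\<close>). As in \<open>HOL-Algebra.Indexed_Polynomials\<close>, a monomial
  is the multiset of its variables, and a series is its coefficient function; the support of a
  series is unrestricted except that only the first \<open>d\<close> variables may occur.
\<close>

definition power_series :: "nat \<Rightarrow> (nat multiset \<Rightarrow> 'a::comm_ring_1) ring" where
  "power_series d = \<lparr>
     carrier = {f. \<forall>M. f M \<noteq> 0 \<longrightarrow> set_mset M \<subseteq> {..<d}},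
     monoid.mult = (\<lambda>f g M. \<Sum>A | A \<subseteq># M. f A * g (M - A)),
     one = (\<lambda>M. if M = {#} then 1 else 0),
     zero = (\<lambda>M. 0),
     add = (\<lambda>f g M. f M + g M)\<rparr>"

definition ps_const :: "'a \<Rightarrow> nat multiset \<Rightarrow> 'a::comm_ring_1" where
  "ps_const c = (\<lambda>M. if M = {#} then c else 0)"

definition ps_var :: "nat \<Rightarrow> nat multiset \<Rightarrow> 'a::comm_ring_1" where
  "ps_var i = (\<lambda>M. if M = {#i#} then 1 else 0)"

text \<open>
  Taking constant coefficients identifies the residue field of \<open>l[[x\<^sub>0, \<dots>, x\<^sub>d\<^sub>-\<^sub>1]]\<close> with \<open>l\<close>. A ring
  automorphism \<open>h\<close> preserves the maximal ideal, so the induced map on the residue field sends the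
  class \<open>c\<close> to the class of \<open>h\<close> applied to any representative of \<open>c\<close>, here the constant series.
\<close>

definition residue_map ::
    "((nat multiset \<Rightarrow> 'a) \<Rightarrow> nat multiset \<Rightarrow> 'a) \<Rightarrow> 'a \<Rightarrow> 'a::comm_ring_1" where
  "residue_map h c = h (ps_const c) {#}"

definition residue_fixed_field ::
    "('g, 'm) monoid_scheme \<Rightarrow> ('g \<Rightarrow> (nat multiset \<Rightarrow> 'a) \<Rightarrow> nat multiset \<Rightarrow> 'a)
      \<Rightarrow> 'a::comm_ring_1 set" where
  "residue_fixed_field G \<rho> = {c. \<forall>g\<in>carrier G. residue_map (\<rho> g) c = c}"

definition GL :: "nat \<Rightarrow> 'a::field mat monoid" where
  "GL d = units_of (ring_mat TYPE('a) d ())"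

definition Gal :: "'a::field set \<Rightarrow> ('a \<Rightarrow> 'a) monoid" where
  "Gal K = \<lparr>carrier = {\<sigma>. field_hom \<sigma> \<and> bij \<sigma> \<and> (\<forall>c\<in>K. \<sigma> c = c)}, monoid.mult = (\<circ>), one = id\<rparr>"

definition semidirect_product ::
    "('n, 'r) monoid_scheme \<Rightarrow> ('h, 's) monoid_scheme \<Rightarrow> ('h \<Rightarrow> 'n \<Rightarrow> 'n) \<Rightarrow> ('n \<times> 'h) monoid" where
  "semidirect_product N H \<alpha> = \<lparr>
     carrier = carrier N \<times> carrier H,
     monoid.mult = (\<lambda>(a, s) (b, t). (a \<otimes>\<^bsub>N\<^esub> \<alpha> s b, s \<otimes>\<^bsub>H\<^esub> t)),
     one = (\<one>\<^bsub>N\<^esub>, \<one>\<^bsub>H\<^esub>)\<rparr>"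

definition semilinear_group :: "nat \<Rightarrow> 'a::field set \<Rightarrow> ('a mat \<times> ('a \<Rightarrow> 'a)) monoid" where
  "semilinear_group d K = semidirect_product (GL d) (Gal K) map_mat"

definition linear_form :: "nat \<Rightarrow> 'a::field mat \<Rightarrow> nat \<Rightarrow> nat multiset \<Rightarrow> 'a" where
  "linear_form d A j =
     (\<Oplus>\<^bsub>power_series d\<^esub> i\<in>{..<d}. ps_const (A $$ (i, j)) \<otimes>\<^bsub>power_series d\<^esub> ps_var i)"

text \<open>
  The continuous ring endomorphism determined by \<open>(A, \<sigma>)\<close> sends the series with coefficients \<open>f\<^sub>M\<close>
  to \<open>\<Sum>\<^sub>M \<sigma>(f\<^sub>M) \<Prod>\<^sub>j L\<^sub>j ^ count M j\<close>, where \<open>L\<^sub>j = (A, \<sigma>)(x\<^sub>j)\<close> is a linear form. Hence only the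
  finitely many \<open>M\<close> of the same degree as \<open>N\<close> contribute to the coefficient at \<open>N\<close>.
\<close>

definition semilinear_act ::
    "nat \<Rightarrow> 'a::field mat \<times> ('a \<Rightarrow> 'a) \<Rightarrow> (nat multiset \<Rightarrow> 'a) \<Rightarrow> nat multiset \<Rightarrow> 'a" where
  "semilinear_act d = (\<lambda>(A, \<sigma>) f N.
     \<Sum>M\<in>multisets_of_size {..<d} (size N).
       \<sigma> (f M) * (\<Otimes>\<^bsub>power_series d\<^esub> j\<in>{..<d}.
                     linear_form d A j [^]\<^bsub>power_series d\<^esub> count M j) N)"

text \<open>The subring of elements of \<open>R\<close> fixed by every \<open>act g\<close> with \<open>g \<in> X\<close>.\<close>

definition invariant_ring :: "('r, 'm) ring_scheme \<Rightarrow> ('g \<Rightarrow> 'r \<Rightarrow> 'r) \<Rightarrow> 'g set \<Rightarrow> ('r, 'm) ring_scheme" where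
  "invariant_ring R act X = R\<lparr>carrier := {f \<in> carrier R. \<forall>g\<in>X. act g f = f}\<rparr>"

lemma finite_submultisets: "finite {A. A \<subseteq># M}"
proof (induction M)
  case (add x M)
  have "{A. A \<subseteq># add_mset x M} \<subseteq> {A. A \<subseteq># M} \<union> add_mset x ` {A. A \<subseteq># M}"
  proof
    fix A assume A: "A \<in> {A. A \<subseteq># add_mset x M}"
    show "A \<in> {A. A \<subseteq># M} \<union> add_mset x ` {A. A \<subseteq># M}"
    proof (cases "x \<in># A")
      case True
      then obtain B where B: "A = add_mset x B" by (metis multi_member_split)
      with A show ?thesis by auto
    next
      case False
      have "count A y \<le> count M y" for y
        using A False mset_subset_eq_count[of A "add_mset x M" y]
        by (cases "y = x") (auto simp: not_in_iff)
      then have "A \<subseteq># M" by (simp add: subseteq_mset_def)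
      then show ?thesis by simp
    qed
  qed
  with add show ?case by (meson finite_UnI finite_imageI finite_subset)
qed simp

lemma power_series_cring: "cring (power_series d :: (nat multiset \<Rightarrow> 'a::comm_ring_1) ring)"
proof (rule cringI)
  let ?S = "power_series d :: (nat multiset \<Rightarrow> 'a) ring"
  show "abelian_group ?S"
  proof (rule abelian_groupI, goal_cases)
    case (1 f g)
    then show ?case by (auto simp: power_series_def) (metis add_0 lessThan_iff subsetD)
  next
    case (6 f)
    then show ?case by (intro bexI[of _ "\<lambda>M. - f M"]) (auto simp: power_series_def)
  qed (auto simp: power_series_def algebra_simps)
  have closed: "f \<otimes>\<^bsub>?S\<^esub> g \<in> carrier ?S" if f: "f \<in> carrier ?S" and g: "g \<in> carrier ?S" for f g
  proof -
    have "set_mset M \<subseteq> {..<d}" if nz: "(\<Sum>A | A \<subseteq># M. f A * g (M - A)) \<noteq> 0" for M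
    proof -
      obtain A where A: "A \<subseteq># M" "f A * g (M - A) \<noteq> 0"
        using nz by (metis (mono_tags, lifting) mem_Collect_eq sum.neutral)
      then have "set_mset A \<subseteq> {..<d}" "set_mset (M - A) \<subseteq> {..<d}"
        using f g by (force simp: power_series_def)+
      moreover have "M = A + (M - A)" using A by simp
      ultimately show ?thesis by (metis Un_least set_mset_union)
    qed
    then show ?thesis by (simp add: power_series_def)
  qed
  show "comm_monoid ?S"
  proof (rule comm_monoidI, goal_cases)
    case (1 f g) then show ?case by (rule closed)
  next
    case 2 show ?case by (auto simp: power_series_def)
  next
    case (3 f g h)
    have "(\<Sum>A | A \<subseteq># M. (\<Sum>B | B \<subseteq># A. f B * g (A - B)) * h (M - A))
        = (\<Sum>A | A \<subseteq># M. f A * (\<Sum>B | B \<subseteq># M - A. g B * h (M - A - B)))" for M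
      unfolding sum_distrib_left sum_distrib_right
      unfolding sum.Sigma[OF finite_submultisets ballI[OF finite_submultisets]]
    proof (rule sum.reindex_bij_witness[of _ "\<lambda>(B, C). (B + C, B)" "\<lambda>(A, B). (B, A - B)"], goal_cases)
      case (1 p) then show ?case by auto
    next
      case (2 p) then show ?case
        by (auto simp: subseteq_mset_def diff_le_mono intro: order.trans)
    next
      case (3 p) then show ?case by auto
    next
      case (4 p) then show ?case
        by (auto) (metis add.commute subset_mset.le_diff_conv2)
    next
      case (5 p) then show ?case by (auto simp: mult.assoc)
    qed
    then show ?case by (auto simp: power_series_def)
  next
    case (4 f)
    have "(\<Sum>A | A \<subseteq># M. (if A = {#} then 1 else 0) * f (M - A)) = (\<Sum>A | A \<subseteq># M. if A = {#} then f M else 0)" for M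
      by (rule sum.cong) auto
    then show ?case by (auto simp: power_series_def finite_submultisets)
  next
    case (5 f g)
    have dd: "M - (M - A) = A" if "A \<subseteq># M" for A M :: "nat multiset"
      using that by (simp add: multiset_eq_iff subseteq_mset_def)
    have "(\<Sum>A | A \<subseteq># M. f A * g (M - A)) = (\<Sum>A | A \<subseteq># M. g A * f (M - A))" for M
      by (rule sum.reindex_bij_witness[of _ "\<lambda>A. M - A" "\<lambda>A. M - A"])
        (auto simp: dd mult.commute)
    then show ?case by (auto simp: power_series_def)
  qed
  fix f g h
  show "(f \<oplus>\<^bsub>?S\<^esub> g) \<otimes>\<^bsub>?S\<^esub> h = f \<otimes>\<^bsub>?S\<^esub> h \<oplus>\<^bsub>?S\<^esub> g \<otimes>\<^bsub>?S\<^esub> h"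
    by (simp add: power_series_def distrib_right sum.distrib)
qed

text \<open>The values of \<^const>\<open>semilinear_act\<close> on scalars and variables.\<close>

lemma linear_form_eq:
  "linear_form d A j = (\<lambda>M. \<Sum>i<d. if M = {#i#} then A $$ (i, j) else 0)"
proof -
  interpret cring "power_series d :: (nat multiset \<Rightarrow> 'a::field) ring"
    by (rule power_series_cring)
  let ?S = "power_series d :: (nat multiset \<Rightarrow> 'a) ring"
  have prod: "ps_const c \<otimes>\<^bsub>?S\<^esub> ps_var i = (\<lambda>M. if M = {#i#} then c else 0)" for c i
  proof
    fix M :: "nat multiset"
    have "(\<Sum>A | A \<subseteq># M. ps_const c A * ps_var i (M - A))
        = (\<Sum>A | A \<subseteq># M. if A = {#} then if M = {#i#} then c else 0 else 0)"
      by (rule sum.cong) (auto simp: ps_const_def ps_var_def)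
    then show "(ps_const c \<otimes>\<^bsub>?S\<^esub> ps_var i) M = (if M = {#i#} then c else 0)"
      by (simp add: power_series_def finite_submultisets)
  qed
  have mem: "(\<lambda>M. if M = {#i#} then c else 0) \<in> carrier ?S" if "i < d" for i c
    using that by (auto simp: power_series_def)
  have "(\<Oplus>\<^bsub>?S\<^esub> i\<in>{..<k}. ps_const (A $$ (i, j)) \<otimes>\<^bsub>?S\<^esub> ps_var i)
      = (\<lambda>M. \<Sum>i<k. if M = {#i#} then A $$ (i, j) else 0)" if "k \<le> d" for k
    using that
  proof (induction k)
    case 0 show ?case by simp (simp add: power_series_def)
  next
    case (Suc k)
    have "(\<Oplus>\<^bsub>?S\<^esub> i\<in>{..<Suc k}. ps_const (A $$ (i, j)) \<otimes>\<^bsub>?S\<^esub> ps_var i)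
        = ps_const (A $$ (k, j)) \<otimes>\<^bsub>?S\<^esub> ps_var k
          \<oplus>\<^bsub>?S\<^esub> (\<Oplus>\<^bsub>?S\<^esub> i\<in>{..<k}. ps_const (A $$ (i, j)) \<otimes>\<^bsub>?S\<^esub> ps_var i)"
      unfolding lessThan_Suc using Suc.prems by (subst finsum_insert) (auto simp: prod intro!: mem)
    with Suc show ?case by (simp add: prod) (simp add: power_series_def add.commute)
  qed
  then show ?thesis by (simp add: linear_form_def)
qed

lemma linear_form_closed: "linear_form d A j \<in> carrier (power_series d)"
  by (force simp: linear_form_eq power_series_def split: if_splits
      elim!: sum.not_neutral_contains_not_neutral)

lemma semilinear_act_const:
  assumes "\<sigma> 0 = 0"
  shows "semilinear_act d (A, \<sigma>) (ps_const c) = ps_const (\<sigma> c)"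
proof
  fix N :: "nat multiset"
  interpret cring "power_series d :: (nat multiset \<Rightarrow> 'a) ring" by (rule power_series_cring)
  let ?S = "power_series d :: (nat multiset \<Rightarrow> 'a) ring"
  let ?P = "\<lambda>M. \<Otimes>\<^bsub>?S\<^esub> j\<in>{..<d}. linear_form d A j [^]\<^bsub>?S\<^esub> count M j"
  have P: "?P {#} = \<one>\<^bsub>?S\<^esub>" by (simp add: finprod_one_eqI)
  have fin: "finite (multisets_of_size {..<d} (size N))"
    by (rule finite_multisets_of_size) simp
  have "semilinear_act d (A, \<sigma>) (ps_const c) N
      = (\<Sum>M\<in>multisets_of_size {..<d} (size N). if M = {#} then \<sigma> c * ?P {#} N else 0)"
    by (auto simp: semilinear_act_def ps_const_def assms intro!: sum.cong)
  also have "\<dots> = ps_const (\<sigma> c) N"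
    unfolding P using fin by (auto simp: power_series_def ps_const_def multisets_of_size_def)
  finally show "semilinear_act d (A, \<sigma>) (ps_const c) N = ps_const (\<sigma> c) N" .
qed

lemma semilinear_act_var:
  assumes "\<sigma> 0 = 0" "\<sigma> 1 = 1" "j < d"
  shows "semilinear_act d (A, \<sigma>) (ps_var j) = linear_form d A j"
proof
  fix N :: "nat multiset"
  interpret cring "power_series d :: (nat multiset \<Rightarrow> 'a) ring" by (rule power_series_cring)
  let ?S = "power_series d :: (nat multiset \<Rightarrow> 'a) ring"
  let ?P = "\<lambda>M. \<Otimes>\<^bsub>?S\<^esub> j\<in>{..<d}. linear_form d A j [^]\<^bsub>?S\<^esub> count M j"
  have "?P {#j#} = (\<Otimes>\<^bsub>?S\<^esub> i\<in>{..<d}. if j = i then linear_form d A i else \<one>\<^bsub>?S\<^esub>)"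
    by (rule finprod_cong') (auto simp: linear_form_closed)
  then have P: "?P {#j#} = linear_form d A j"
    using assms finprod_singleton[of j "{..<d}" "linear_form d A"] linear_form_closed by auto
  have fin: "finite (multisets_of_size {..<d} (size N))"
    by (rule finite_multisets_of_size) simp
  have "semilinear_act d (A, \<sigma>) (ps_var j) N
      = (\<Sum>M\<in>multisets_of_size {..<d} (size N). if M = {#j#} then ?P {#j#} N else 0)"
    by (auto simp: semilinear_act_def ps_var_def assms intro!: sum.cong)
  also have "\<dots> = (if size N = 1 then linear_form d A j N else 0)"
    unfolding P using fin assms by (auto simp: multisets_of_size_def)
  also have "\<dots> = linear_form d A j N"
    by (auto simp: linear_form_eq intro!: sum.neutral[symmetric] sum.neutral)
  finally show "semilinear_act d (A, \<sigma>) (ps_var j) N = linear_form d A j N" .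
qed

end

theory Submission
  imports Defs
begin

text \<open>
  Every automorphism \<open>g\<close> preserves the maximal ideal, hence induces a graded automorphism \<open>gr g\<close> of
  the associated graded ring \<open>l[x\<^sub>0, \<dots>, x\<^sub>d\<^sub>-\<^sub>1]\<close>, which is the semilinear map given by the linear
  part of \<open>g\<close> and its residue map. It remains to conjugate the action \<open>g\<close> to \<open>gr g\<close>. Suppose that
  they agree modulo terms that raise the order by \<open>n \<ge> 1\<close>. Then \<open>g (gr g)\<^sup>-\<^sup>1 = 1 + E\<^sub>g + \<dots>\<close> with \<open>E\<close> a
  1-cocycle with values in the graded derivations of degree \<open>n\<close>, and averaging shows that
  \<open>E\<close> is the coboundary of \<open>|G|\<^sup>-\<^sup>1 \<Sum>\<^sub>h E\<^sub>h\<close>. For the conjugation this derivation has to be the leading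
  term of some ring automorphism. The sum is the leading term of the product of all \<open>h (gr h)\<^sup>-\<^sup>1\<close>;
  substituting \<open>|G| x\<^sub>i\<close> for \<open>x\<^sub>i\<close> divides it by \<open>|G|\<^sup>n\<close>, and taking the \<open>|G|\<^sup>n\<^sup>-\<^sup>1\<close>-th power yields
  \<open>|G|\<^sup>-\<^sup>1\<close> times it. The infinite product of these conjugations converges. In particular no
  equivariant version of Cohen's structure theorem is needed.
\<close>

section \<open>Formal power series as a commutative ring type\<close>

typedef 'a mps = "UNIV :: (nat multiset \<Rightarrow> 'a) set"
  morphisms mps_nth Abs_mps by simp

setup_lifting type_definition_mps

lemma mps_eqI: "(\<And>M. mps_nth f M = mps_nth g M) \<Longrightarrow> f = g"
  by transfer auto

lemma mps_nth_Abs [simp]: "mps_nth (Abs_mps f) = f"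
  by (simp add: Abs_mps_inverse)

instantiation mps :: (comm_ring_1) ab_group_add
begin

lift_definition zero_mps :: "'a mps" is "\<lambda>M. 0" .
lift_definition plus_mps :: "'a mps \<Rightarrow> 'a mps \<Rightarrow> 'a mps" is "\<lambda>f g M. f M + g M" .
lift_definition uminus_mps :: "'a mps \<Rightarrow> 'a mps" is "\<lambda>f M. - f M" .
lift_definition minus_mps :: "'a mps \<Rightarrow> 'a mps \<Rightarrow> 'a mps" is "\<lambda>f g M. f M - g M" .

instance by standard (transfer; simp add: algebra_simps fun_eq_iff)+

end

lemma mps_nth_simps [simp]:
  "mps_nth 0 M = 0"
  "mps_nth (f + g) M = mps_nth f M + mps_nth g M"
  "mps_nth (- f) M = - mps_nth f M"
  "mps_nth (f - g) M = mps_nth f M - mps_nth g M"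
  by (transfer; simp)+

lemma mps_nth_sum [simp]: "mps_nth (\<Sum>i\<in>I. f i) M = (\<Sum>i\<in>I. mps_nth (f i) M)"
  by (induction I rule: infinite_finite_induct) auto

text \<open>The substitution \<open>x_i = 0\<close> for all \<open>i \<ge> d\<close>, a ring
  endomorphism whose image is the ring in the first \<open>d\<close> variables.\<close>

lift_definition restrict_vars :: "nat \<Rightarrow> 'a::comm_ring_1 mps \<Rightarrow> 'a mps" is
  "\<lambda>d f M. if set_mset M \<subseteq> {..<d} then f M else 0" .

lemma mps_nth_restrict: "mps_nth (restrict_vars d f) M = (if set_mset M \<subseteq> {..<d} then mps_nth f M else 0)"
  by transfer simp

lemma mps_nth_restrict_carrier: "mps_nth (restrict_vars d f) \<in> carrier (power_series d)"
  by (auto simp: power_series_def mps_nth_restrict)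

lemma restrict_eq_iff: "restrict_vars d f = f \<longleftrightarrow> mps_nth f \<in> carrier (power_series d)"
proof
  assume "restrict_vars d f = f"
  then show "mps_nth f \<in> carrier (power_series d)"
    using mps_nth_restrict_carrier[of d f] by simp
next
  assume "mps_nth f \<in> carrier (power_series d)"
  then have "mps_nth f M = 0" if "\<not> set_mset M \<subseteq> {..<d}" for M
    using that unfolding power_series_def by auto
  then show "restrict_vars d f = f"
    by (intro mps_eqI) (simp add: mps_nth_restrict)
qed

text \<open>A monomial involves finitely many variables, so each coefficient survives some
  restriction. This carries the ring laws of all \<open>power_series d\<close> over to the
  type.\<close>

lemma restrict_extensionality:
  assumes "\<And>d. restrict_vars d f = restrict_vars d g"
  shows "f = g"
proof (rule mps_eqI)
  fix M :: "nat multiset"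
  obtain d where "set_mset M \<subseteq> {..<d}"
    using finite_nat_set_iff_bounded[of "set_mset M"] by auto
  then show "mps_nth f M = mps_nth g M"
    using arg_cong[OF assms[of d], of "\<lambda>f. mps_nth f M"] by (simp add: mps_nth_restrict)
qed

instantiation mps :: (comm_ring_1) "{one, times}"
begin

lift_definition one_mps :: "'a mps" is "\<lambda>M. if M = {#} then 1 else 0" .
lift_definition times_mps :: "'a mps \<Rightarrow> 'a mps \<Rightarrow> 'a mps" is
  "\<lambda>f g M. \<Sum>A | A \<subseteq># M. f A * g (M - A)" .

instance ..

end

lemma mps_nth_one: "mps_nth 1 M = (if M = {#} then 1 else 0)"
  by transfer simp

lemma mps_nth_mult: "mps_nth (f * g) M = (\<Sum>A | A \<subseteq># M. mps_nth f A * mps_nth g (M - A))"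
  by transfer simp

lemma mps_nth_mult_empty [simp]: "mps_nth (f * g) {#} = mps_nth f {#} * mps_nth g {#}"
  by (simp add: mps_nth_mult)

lemma mps_nth_mult_eq_mult:
  "mps_nth (f * g) = mps_nth f \<otimes>\<^bsub>power_series d\<^esub> mps_nth g"
  by transfer (simp add: power_series_def)

lemma mps_nth_one_eq_one: "mps_nth 1 = \<one>\<^bsub>power_series d\<^esub>"
  by transfer (simp add: power_series_def)

lemma mps_nth_add_eq_add: "mps_nth (f + g) = mps_nth f \<oplus>\<^bsub>power_series d\<^esub> mps_nth g"
  by transfer (simp add: power_series_def)

text \<open>For \<open>A\<close> contained in \<open>M\<close>, the first \<open>d\<close> variables
  suffice for \<open>M\<close> exactly when they suffice for both \<open>A\<close> and
  \<open>M - A\<close>; so the convolution restricts termwise.\<close>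

lemma restrict_mult: "restrict_vars d (f * g) = restrict_vars d f * restrict_vars d g"
proof (rule mps_eqI)
  fix M :: "nat multiset"
  have "mps_nth (restrict_vars d f * restrict_vars d g) M = mps_nth (f * g) M" if "set_mset M \<subseteq> {..<d}"
  proof -
    have "set_mset A \<subseteq> {..<d} \<and> set_mset (M - A) \<subseteq> {..<d}" if "A \<subseteq># M" for A
      using that \<open>set_mset M \<subseteq> {..<d}\<close> set_mset_mono[OF that] set_mset_mono[OF diff_subset_eq_self[of M A]]
      by blast
    then show ?thesis
      unfolding mps_nth_mult mps_nth_restrict by (intro sum.cong) simp_all
  qed
  moreover have "mps_nth (restrict_vars d f * restrict_vars d g) M = 0" if M: "\<not> set_mset M \<subseteq> {..<d}"
  proof -
    have "set_mset M \<subseteq> set_mset A \<union> set_mset (M - A)" if "A \<subseteq># M" for A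
      using that by (metis order_refl set_mset_union subset_mset.add_diff_inverse)
    then have "\<not> set_mset A \<subseteq> {..<d} \<or> \<not> set_mset (M - A) \<subseteq> {..<d}" if "A \<subseteq># M" for A
      using that M by blast
    then show ?thesis
      unfolding mps_nth_mult mps_nth_restrict by (intro sum.neutral) auto
  qed
  ultimately show "mps_nth (restrict_vars d (f * g)) M = mps_nth (restrict_vars d f * restrict_vars d g) M"
    by (auto simp: mps_nth_restrict)
qed

instance mps :: (comm_ring_1) comm_ring_1
proof
  fix f g h :: "'a mps"
  show "f * g * h = f * (g * h)"
  proof (rule restrict_extensionality)
    fix d
    interpret cring "power_series d :: (nat multiset \<Rightarrow> 'a) ring" by (rule power_series_cring)
    show "restrict_vars d (f * g * h) = restrict_vars d (f * (g * h))"
      unfolding restrict_mult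
      by (rule mps_eqI) (simp only: mps_nth_mult_eq_mult[of _ _ d] m_assoc mps_nth_restrict_carrier)
  qed
  show "f * g = g * f"
  proof (rule restrict_extensionality)
    fix d
    interpret cring "power_series d :: (nat multiset \<Rightarrow> 'a) ring" by (rule power_series_cring)
    have "mps_nth (restrict_vars d f * restrict_vars d g) = mps_nth (restrict_vars d g * restrict_vars d f)"
      unfolding mps_nth_mult_eq_mult[of _ _ d] by (intro m_comm mps_nth_restrict_carrier)
    then show "restrict_vars d (f * g) = restrict_vars d (g * f)"
      by (simp add: restrict_mult mps_nth_inject)
  qed
  show "1 * f = f"
  proof (rule mps_eqI)
    fix M
    have "(\<Sum>A | A \<subseteq># M. (if A = {#} then 1 else 0) * mps_nth f (M - A))
        = (\<Sum>A | A \<subseteq># M. if A = {#} then mps_nth f M else 0)"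
      by (rule sum.cong) auto
    then show "mps_nth (1 * f) M = mps_nth f M"
      by (simp add: mps_nth_mult mps_nth_one finite_submultisets)
  qed
  show "(f + g) * h = f * h + g * h"
    by (rule mps_eqI) (simp add: mps_nth_mult distrib_right sum.distrib)
  have "mps_nth (1 :: 'a mps) {#} \<noteq> mps_nth 0 {#}" by (simp add: mps_nth_one)
  then show "(0 :: 'a mps) \<noteq> 1" by metis
qed

lemma restrict_add: "restrict_vars d (f + g) = restrict_vars d f + restrict_vars d g"
  by (rule mps_eqI) (simp add: mps_nth_restrict)

lemma restrict_one [simp]: "restrict_vars d 1 = 1"
  by (rule mps_eqI) (simp add: mps_nth_restrict mps_nth_one)

lemma restrict_restrict [simp]: "restrict_vars d (restrict_vars d f) = restrict_vars d f"
  by (rule mps_eqI) (simp add: mps_nth_restrict)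

lift_definition mps_const :: "'a \<Rightarrow> 'a::comm_ring_1 mps" is ps_const .
lift_definition mps_var :: "nat \<Rightarrow> 'a::comm_ring_1 mps" is ps_var .
lift_definition mps_monom :: "nat multiset \<Rightarrow> 'a::comm_ring_1 mps" is "\<lambda>M N. if N = M then 1 else 0" .

lemma mps_nth_const: "mps_nth (mps_const c) M = (if M = {#} then c else 0)"
  by transfer (simp add: ps_const_def)

lemma mps_nth_monom: "mps_nth (mps_monom M) N = (if N = M then 1 else 0)"
  by transfer simp

lemma mps_var_eq_monom: "mps_var i = mps_monom {#i#}"
  by transfer (simp add: ps_var_def fun_eq_iff)

lemma mps_monom_empty: "mps_monom {#} = 1"
  by (rule mps_eqI) (simp add: mps_nth_monom mps_nth_one)

lemma mps_nth_const_mult [simp]: "mps_nth (mps_const c * f) M = c * mps_nth f M"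
proof -
  have "(\<Sum>A | A \<subseteq># M. mps_nth (mps_const c) A * mps_nth f (M - A))
      = (\<Sum>A | A \<subseteq># M. if A = {#} then c * mps_nth f M else 0)"
    by (rule sum.cong) (auto simp: mps_nth_const)
  then show ?thesis by (simp add: mps_nth_mult finite_submultisets)
qed

lemma mps_const_mult: "mps_const (a * b) = mps_const a * mps_const b"
  by (rule mps_eqI) (simp add: mps_nth_const)

lemma mps_const_add: "mps_const (a + b) = mps_const a + mps_const b"
  by (rule mps_eqI) (simp add: mps_nth_const)

lemma mps_const_one [simp]: "mps_const 1 = 1"
  by (rule mps_eqI) (simp add: mps_nth_const mps_nth_one)

lemma mps_const_zero [simp]: "mps_const 0 = 0"
  by (rule mps_eqI) (simp add: mps_nth_const)

lemma mps_const_of_nat: "mps_const (of_nat n) = of_nat n"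
  by (induction n) (simp_all add: mps_const_add)

lemma mps_nth_monom_mult:
  "mps_nth (mps_monom A * f) M = (if A \<subseteq># M then mps_nth f (M - A) else 0)"
proof -
  have "(\<Sum>B | B \<subseteq># M. mps_nth (mps_monom A) B * mps_nth f (M - B))
      = (\<Sum>B | B \<subseteq># M. if B = A then mps_nth f (M - A) else 0)"
    by (rule sum.cong) (auto simp: mps_nth_monom)
  then show ?thesis by (simp add: mps_nth_mult finite_submultisets)
qed

lemma mps_monom_mult: "mps_monom A * mps_monom B = mps_monom (A + B)"
  by (rule mps_eqI) (auto simp: mps_nth_monom_mult mps_nth_monom subset_mset.le_diff_conv2)

lemma mps_monom_eq_prod_var:
  assumes "set_mset M \<subseteq> {..<d}"
  shows "(mps_monom M :: 'a::comm_ring_1 mps) = (\<Prod>j<d. mps_var j ^ count M j)"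
  using assms
proof (induction M)
  case empty
  show ?case by (simp add: mps_monom_empty)
next
  case (add x M)
  then have "x < d" by simp
  have "(\<Prod>j<d. mps_var j ^ count (add_mset x M) j :: 'a mps)
      = (\<Prod>j<d. (if j = x then mps_var x else 1) * mps_var j ^ count M j)"
    by (rule prod.cong) auto
  also have "\<dots> = mps_var x * (\<Prod>j<d. mps_var j ^ count M j)"
    using \<open>x < d\<close> by (simp add: prod.distrib)
  also have "(\<Prod>j<d. mps_var j ^ count M j) = (mps_monom M :: 'a mps)"
    using add by simp
  also have "mps_var x * mps_monom M = mps_monom (add_mset x M)"
    by (simp add: mps_var_eq_monom mps_monom_mult)
  finally show ?case by simp
qed

section \<open>The filtration by order and completeness\<close>

definition order_ge :: "nat \<Rightarrow> 'a::comm_ring_1 mps set" where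
  "order_ge k = {f. \<forall>M. size M < k \<longrightarrow> mps_nth f M = 0}"

lemma order_geD: "f \<in> order_ge k \<Longrightarrow> size M < k \<Longrightarrow> mps_nth f M = 0"
  by (simp add: order_ge_def)

lemma order_ge_0 [simp]: "f \<in> order_ge 0"
  by (simp add: order_ge_def)

lemma zero_in_order_ge [simp]: "0 \<in> order_ge k"
  by (simp add: order_ge_def)

lemma order_ge_mono: "f \<in> order_ge k \<Longrightarrow> j \<le> k \<Longrightarrow> f \<in> order_ge j"
  by (simp add: order_ge_def)

lemma order_ge_add: "f \<in> order_ge k \<Longrightarrow> g \<in> order_ge k \<Longrightarrow> f + g \<in> order_ge k"
  by (simp add: order_ge_def)

lemma order_ge_diff: "f \<in> order_ge k \<Longrightarrow> g \<in> order_ge k \<Longrightarrow> f - g \<in> order_ge k"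
  by (simp add: order_ge_def)

lemma order_ge_uminus: "f \<in> order_ge k \<Longrightarrow> - f \<in> order_ge k"
  by (simp add: order_ge_def)

lemma order_ge_sum: "(\<And>i. i \<in> I \<Longrightarrow> f i \<in> order_ge k) \<Longrightarrow> (\<Sum>i\<in>I. f i) \<in> order_ge k"
  by (induction I rule: infinite_finite_induct) (auto intro: order_ge_add)

lemma order_ge_restrict: "f \<in> order_ge k \<Longrightarrow> restrict_vars d f \<in> order_ge k"
  by (simp add: order_ge_def mps_nth_restrict)

lemma order_ge_mult:
  assumes "f \<in> order_ge i" "g \<in> order_ge j"
  shows "f * g \<in> order_ge (i + j)"
proof -
  have "mps_nth f A * mps_nth g (M - A) = 0" if "A \<subseteq># M" "size M < i + j" for A M
  proof -
    have "size A < i \<or> size (M - A) < j"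
      using that size_mset_mono[OF that(1)] by (simp add: size_Diff_submset) linarith
    then show ?thesis using assms by (auto dest: order_geD)
  qed
  then show ?thesis
    by (auto simp: order_ge_def mps_nth_mult intro!: sum.neutral)
qed

lemma order_ge_mult_left: "g \<in> order_ge k \<Longrightarrow> f * g \<in> order_ge k"
  using order_ge_mult[of f 0 g k] by simp

lemma order_ge_power: "f \<in> order_ge 1 \<Longrightarrow> f ^ n \<in> order_ge n"
  by (induction n) (auto dest: order_ge_mult)

lemma order_ge_separated: "(\<And>n. f \<in> order_ge n) \<Longrightarrow> f = 0"
  by (rule mps_eqI) (auto simp: order_ge_def)

lemma mps_eqI_order_ge:
  assumes "\<And>n. f - g \<in> order_ge n"
  shows "f = g"
  using order_ge_separated[OF assms] by simp

lemma order_ge_eventually_const: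
  assumes "\<And>n. s (Suc n) - s n \<in> order_ge n" "n \<le> m"
  shows "s m - s n \<in> order_ge n"
  using assms(2)
proof (induction m rule: dec_induct)
  case (step m)
  have "s (Suc m) - s m \<in> order_ge n"
    using assms(1) step order_ge_mono by blast
  from order_ge_add[OF this step.IH] show ?case by simp
qed simp

lemma order_ge_complete:
  assumes s: "\<And>n. s (Suc n) - s n \<in> order_ge n"
  obtains l where "\<And>n. l - s n \<in> order_ge n"
proof
  \<comment> \<open>The coefficient at \<open>M\<close> is stable from index
    \<open>size M + 1\<close> on, since the step from \<open>n\<close> to \<open>n + 1\<close>
    affects only degrees at least \<open>n\<close>.\<close>
  define l where "l = Abs_mps (\<lambda>M. mps_nth (s (Suc (size M))) M)"
  fix n
  have "mps_nth l M = mps_nth (s n) M" if "size M < n" for M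
    using order_geD[OF order_ge_eventually_const[of s, OF s], of "Suc (size M)" n M] that
    by (simp add: l_def)
  then show "l - s n \<in> order_ge n" by (simp add: order_ge_def)
qed

text \<open>Geometric series: dividing \<open>f\<close> by its constant term gives
  \<open>1 - p\<close> with \<open>p\<close> of positive order, and the partial sums of the powers
  of \<open>p\<close> converge to an inverse.\<close>

lemma mps_invertible:
  fixes f :: "'a::field mps"
  assumes "mps_nth f {#} \<noteq> 0"
  obtains g where "f * g = 1"
proof -
  define c where "c = mps_const (inverse (mps_nth f {#}))"
  define p where "p = 1 - c * f"
  have p: "p \<in> order_ge 1"
    using assms by (simp add: order_ge_def p_def c_def mps_nth_one mps_nth_const)
  define s where "s n = (\<Sum>i<n. p ^ i)" for n
  have "s (Suc n) - s n \<in> order_ge n" for n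
    using order_ge_power[OF p] by (simp add: s_def)
  from order_ge_complete[of s, OF this] obtain l where l: "\<And>n. l - s n \<in> order_ge n" by blast
  have "(1 - p) * l = 1"
  proof (rule mps_eqI_order_ge)
    fix n
    have "(1 - p) * s n = 1 - p ^ n"
      by (simp add: s_def one_diff_power_eq)
    then have "(1 - p) * l - 1 = (1 - p) * (l - s n) - p ^ n"
      by (simp add: algebra_simps)
    then show "(1 - p) * l - 1 \<in> order_ge n"
      using order_ge_mult_left[OF l] order_ge_power[OF p] by (auto intro: order_ge_diff)
  qed
  then have "f * (c * l) = 1" by (simp add: p_def mult_ac)
  then show ?thesis using that by blast
qed

section \<open>Homogeneous components\<close>

lift_definition hom_part :: "nat \<Rightarrow> 'a::comm_ring_1 mps \<Rightarrow> 'a mps" is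
  "\<lambda>k f M. if size M = k then f M else 0" .

lemma mps_nth_hom_part: "mps_nth (hom_part k f) M = (if size M = k then mps_nth f M else 0)"
  by transfer simp

lemma hom_part_add: "hom_part k (f + g) = hom_part k f + hom_part k g"
  by (rule mps_eqI) (simp add: mps_nth_hom_part)

lemma hom_part_order_ge: "hom_part k f \<in> order_ge k"
  by (simp add: order_ge_def mps_nth_hom_part)

lemma hom_part_restrict: "hom_part k (restrict_vars d f) = restrict_vars d (hom_part k f)"
  by (rule mps_eqI) (simp add: mps_nth_hom_part mps_nth_restrict)

lemma diff_hom_part_order_ge: "f \<in> order_ge k \<Longrightarrow> f - hom_part k f \<in> order_ge (Suc k)"
  by (auto simp: order_ge_def mps_nth_hom_part less_Suc_eq)

lemma hom_part_hom_part: "hom_part j (hom_part k f) = (if j = k then hom_part k f else 0)"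
  by (rule mps_eqI) (auto simp: mps_nth_hom_part)

lemma hom_part_mult: "hom_part k (f * g) = (\<Sum>i\<le>k. hom_part i f * hom_part (k - i) g)"
proof (rule mps_eqI)
  fix M :: "nat multiset"
  have "mps_nth (\<Sum>i\<le>k. hom_part i f * hom_part (k - i) g) M
      = (\<Sum>A | A \<subseteq># M. \<Sum>i\<le>k. (if size A = i then mps_nth f A else 0)
          * (if size (M - A) = k - i then mps_nth g (M - A) else 0))"
    by (simp add: mps_nth_mult mps_nth_hom_part sum.swap[of _ "{..k}"])
  also have "\<dots> = (\<Sum>A | A \<subseteq># M. if size M = k then mps_nth f A * mps_nth g (M - A) else 0)"
  proof (rule sum.cong[OF refl])
    fix A assume "A \<in> {A. A \<subseteq># M}"
    then have A: "size (M - A) = size M - size A" "size A \<le> size M"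
      by (auto simp: size_Diff_submset size_mset_mono)
    have "(\<Sum>i\<le>k. (if size A = i then mps_nth f A else 0)
          * (if size (M - A) = k - i then mps_nth g (M - A) else 0))
        = (\<Sum>i\<le>k. if i = size A then (if size (M - A) = k - i then mps_nth f A * mps_nth g (M - A) else 0) else 0)"
      by (rule sum.cong) auto
    also have "\<dots> = (if size M = k then mps_nth f A * mps_nth g (M - A) else 0)"
      using A by (auto simp: sum.delta)
    finally show "(\<Sum>i\<le>k. (if size A = i then mps_nth f A else 0)
          * (if size (M - A) = k - i then mps_nth g (M - A) else 0))
        = (if size M = k then mps_nth f A * mps_nth g (M - A) else 0)" .
  qed
  finally show "mps_nth (hom_part k (f * g)) M
      = mps_nth (\<Sum>i\<le>k. hom_part i f * hom_part (k - i) g) M"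
    by (simp add: mps_nth_hom_part mps_nth_mult)
qed

text \<open>In finitely many variables a homogeneous series is a polynomial, so a ring homomorphism
  can be evaluated on it without any appeal to continuity.\<close>

lemma hom_part_eq_sum_monom:
  assumes "restrict_vars d f = f"
  shows "hom_part k f
    = (\<Sum>M\<in>multisets_of_size {..<d} k. mps_const (mps_nth f M) * mps_monom M)"
proof (rule mps_eqI)
  fix N
  have fin: "finite (multisets_of_size {..<d} k)" by (rule finite_multisets_of_size) simp
  have "mps_nth f N = 0" if "\<not> set_mset N \<subseteq> {..<d}"
    using that assms mps_nth_restrict[of d f N] by simp
  then show "mps_nth (hom_part k f) N
      = mps_nth (\<Sum>M\<in>multisets_of_size {..<d} k. mps_const (mps_nth f M) * mps_monom M) N"
    using fin by (auto simp: mps_nth_hom_part mps_nth_monom multisets_of_size_def if_distrib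
        cong: if_cong)
qed

section \<open>Leading terms of filtered automorphisms\<close>

text \<open>The type \<open>mps\<close> has variables \<open>x\<^sub>i\<close> for all \<open>i\<close>. An endomorphism of the ring in the first \<open>d\<close>
  variables is encoded as an endomorphism of the whole ring that kills the other variables and
  has no other variables in its values, so that \<^term>\<open>restrict_vars d\<close> encodes the identity.\<close>

locale filtered_endo = comm_ring_hom hom
  for d :: nat and hom :: "'a::comm_ring_1 mps \<Rightarrow> 'a mps" +
  assumes hom_restrict: "hom (restrict_vars d f) = hom f"
    and restrict_hom: "restrict_vars d (hom f) = hom f"
    and hom_order_ge: "f \<in> order_ge k \<Longrightarrow> hom f \<in> order_ge k"

lemma filtered_endoI:
  assumes "\<And>f g. u (f + g) = u f + u g"
    and "\<And>f g. u (f * g) = u f * u g"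
    and "u 1 = 1"
    and "\<And>f. u (restrict_vars d f) = u f"
    and "\<And>f. restrict_vars d (u f) = u f"
    and "\<And>f k. f \<in> order_ge k \<Longrightarrow> u f \<in> order_ge k"
  shows "filtered_endo d u"
proof -
  have "u 0 = 0" using assms(1)[of 0 0] by simp
  with assms show ?thesis by unfold_locales auto
qed

lemma filtered_endo_restrict: "filtered_endo d (restrict_vars d)"
  by (rule filtered_endoI) (auto simp: restrict_add restrict_mult order_ge_restrict)

lemma filtered_endo_comp:
  assumes "filtered_endo d u" "filtered_endo d v"
  shows "filtered_endo d (\<lambda>f. u (v f))"
proof -
  interpret u: filtered_endo d u by fact
  interpret v: filtered_endo d v by fact
  show ?thesis
    by (rule filtered_endoI)
      (auto simp: u.hom_add v.hom_add u.hom_mult v.hom_mult v.hom_restrict u.restrict_hom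
        intro: u.hom_order_ge v.hom_order_ge)
qed

text \<open>The inverse is a second argument because it must be filtered as well, and because the
  later limit needs convergence of the inverses too.\<close>

definition filtered_iso :: "nat \<Rightarrow> ('a::comm_ring_1 mps \<Rightarrow> 'a mps) \<Rightarrow> ('a mps \<Rightarrow> 'a mps) \<Rightarrow> bool" where
  "filtered_iso d u v \<longleftrightarrow> filtered_endo d u \<and> filtered_endo d v
    \<and> (\<forall>f. u (v f) = restrict_vars d f) \<and> (\<forall>f. v (u f) = restrict_vars d f)"

lemma filtered_isoD:
  assumes "filtered_iso d u v"
  shows "filtered_endo d u" "filtered_endo d v" "u (v f) = restrict_vars d f" "v (u f) = restrict_vars d f"
  using assms by (auto simp: filtered_iso_def)

lemma filtered_iso_restrict: "filtered_iso d (restrict_vars d) (restrict_vars d)"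
  by (simp add: filtered_iso_def filtered_endo_restrict)

lemma filtered_iso_comp:
  assumes "filtered_iso d u u'" "filtered_iso d v v'"
  shows "filtered_iso d (\<lambda>f. u (v f)) (\<lambda>f. v' (u' f))"
proof -
  note D = filtered_isoD[OF assms(1)] filtered_isoD[OF assms(2)]
  show ?thesis
    unfolding filtered_iso_def
    using D filtered_endo_comp[OF D(1) D(5)] filtered_endo_comp[OF D(6) D(2)]
      filtered_endo.hom_restrict[OF D(1)] filtered_endo.hom_restrict[OF D(6)]
    by simp
qed

text \<open>These axioms are weak enough for the full error \<open>u - 1\<close> to serve as
  \<open>E\<close> in place of its homogeneous part, and no Leibniz rule has to be carried
  along.\<close>

locale graded_op =
  fixes d n :: nat and E :: "'a::comm_ring_1 mps \<Rightarrow> 'a mps"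
  assumes add: "E (f + g) = E f + E g"
    and restrict_vars: "E (restrict_vars d f) = E f"
    and order_ge: "f \<in> order_ge k \<Longrightarrow> E f \<in> order_ge (k + n)"
begin

lemma zero: "E 0 = 0"
  using add[of 0 0] by simp

lemma diff: "E (f - g) = E f - E g"
  using add[of "f - g" g] by (simp add: algebra_simps)

text \<open>The actions may move the scalars, so additivity gives linearity over the integers only.
  Hence the rescaling below is by a natural number.\<close>

lemma of_nat_mult: "E (of_nat m * f) = of_nat m * E f"
  by (induction m) (simp_all add: zero add distrib_right)

end

lemma graded_op_sum:
  assumes "\<And>i. i \<in> I \<Longrightarrow> graded_op d n (E i)"
  shows "graded_op d n (\<lambda>f. \<Sum>i\<in>I. E i f)"
proof
  note D = graded_op.add[OF assms] graded_op.restrict_vars[OF assms] graded_op.order_ge[OF assms]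
  show "(\<Sum>i\<in>I. E i (f + g)) = (\<Sum>i\<in>I. E i f) + (\<Sum>i\<in>I. E i g)" for f g
    unfolding sum.distrib[symmetric] by (intro sum.cong refl D)
  show "(\<Sum>i\<in>I. E i (restrict_vars d f)) = (\<Sum>i\<in>I. E i f)" for f
    by (intro sum.cong refl D)
  show "(\<Sum>i\<in>I. E i f) \<in> order_ge (k + n)" if "f \<in> order_ge k" for f k
    by (intro order_ge_sum D that)
qed

text \<open>\<open>u = 1 + E\<close> up to terms raising the order by more than \<open>n\<close>.\<close>

definition has_lead :: "nat \<Rightarrow> nat \<Rightarrow> ('a::comm_ring_1 mps \<Rightarrow> 'a mps) \<Rightarrow> ('a mps \<Rightarrow> 'a mps) \<Rightarrow> bool" where
  "has_lead d n u E \<longleftrightarrow> (\<forall>k. \<forall>f\<in>order_ge k. u f - restrict_vars d f - E f \<in> order_ge (k + n + 1))"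

lemma has_leadD: "has_lead d n u E \<Longrightarrow> f \<in> order_ge k \<Longrightarrow> u f - restrict_vars d f - E f \<in> order_ge (k + n + 1)"
  by (simp add: has_lead_def)

lemma has_lead_diff_restrict:
  assumes "has_lead d n u E" "graded_op d n E" "f \<in> order_ge k"
  shows "u f - restrict_vars d f \<in> order_ge (k + n)"
proof -
  have "u f - restrict_vars d f - E f \<in> order_ge (k + n)"
    using has_leadD[OF assms(1,3)] by (rule order_ge_mono) simp
  from order_ge_add[OF this graded_op.order_ge[OF assms(2,3)]] show ?thesis by simp
qed

text \<open>In \<open>(1 + E)(1 + E') = 1 + E + E' + E E'\<close> the last term raises the order by
  \<open>2n\<close>, which is at least \<open>n + 1\<close>.\<close>

lemma has_lead_comp:
  assumes "n \<ge> 1" "filtered_endo d v" "graded_op d n E" "graded_op d n E'"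
    and u: "has_lead d n u E" and v: "has_lead d n v E'"
  shows "has_lead d n (\<lambda>f. u (v f)) (\<lambda>f. E f + E' f)"
  unfolding has_lead_def
proof (intro allI ballI)
  fix k and f :: "'a mps" assume f: "f \<in> order_ge k"
  interpret v: filtered_endo d v by fact
  interpret E: graded_op d n E by fact
  have 1: "u (v f) - restrict_vars d (v f) - E (v f) \<in> order_ge (k + n + 1)"
    by (rule has_leadD[OF u v.hom_order_ge[OF f]])
  have 2: "v f - restrict_vars d f - E' f \<in> order_ge (k + n + 1)"
    by (rule has_leadD[OF v f])
  have "E (v f - restrict_vars d f) \<in> order_ge (k + n + n)"
    by (rule E.order_ge[OF has_lead_diff_restrict[OF v assms(4) f]])
  then have 3: "E (v f - restrict_vars d f) \<in> order_ge (k + n + 1)"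
    by (rule order_ge_mono) (use assms(1) in simp)
  have "u (v f) - restrict_vars d f - (E f + E' f)
      = (u (v f) - restrict_vars d (v f) - E (v f)) + (v f - restrict_vars d f - E' f) + E (v f - restrict_vars d f)"
    by (simp add: v.restrict_hom E.diff E.restrict_vars)
  then show "u (v f) - restrict_vars d f - (E f + E' f) \<in> order_ge (k + n + 1)"
    using 1 2 3 by (metis order_ge_add)
qed

text \<open>Composition adds leading terms, so the factors may be composed in whatever order the
  induction over \<open>I\<close> picks them.\<close>

lemma has_lead_sum:
  assumes "finite I" "n \<ge> 1"
    and "\<And>i. i \<in> I \<Longrightarrow> filtered_iso d (z i) (z' i)"
    and "\<And>i. i \<in> I \<Longrightarrow> graded_op d n (E i)"
    and "\<And>i. i \<in> I \<Longrightarrow> has_lead d n (z i) (E i)"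
  shows "\<exists>u u'. filtered_iso d u u' \<and> has_lead d n u (\<lambda>f. \<Sum>i\<in>I. E i f)"
  using assms(1,3-)
proof (induction I)
  case empty
  have "has_lead d n (restrict_vars d) (\<lambda>f. 0)" by (simp add: has_lead_def)
  then show ?case using filtered_iso_restrict by auto
next
  case (insert i I)
  then obtain u u' where u: "filtered_iso d u u'" "has_lead d n u (\<lambda>f. \<Sum>i\<in>I. E i f)" by auto
  have "has_lead d n (\<lambda>f. z i (u f)) (\<lambda>f. E i f + (\<Sum>i\<in>I. E i f))"
    using insert.prems u by (intro has_lead_comp assms(2) graded_op_sum filtered_isoD(1)) auto
  moreover have "filtered_iso d (\<lambda>f. z i (u f)) (\<lambda>f. u' (z' i f))"
    by (rule filtered_iso_comp[OF insert.prems(1) u(1)]) simp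
  ultimately show ?case using insert.hyps by auto
qed

section \<open>Rescaling the variables and dividing leading terms\<close>

lift_definition rescale :: "'a \<Rightarrow> 'a::comm_ring_1 mps \<Rightarrow> 'a mps" is
  "\<lambda>c f M. c ^ size M * f M" .

lemma mps_nth_rescale: "mps_nth (rescale c f) M = c ^ size M * mps_nth f M"
  by transfer simp

lemma rescale_add: "rescale c (f + g) = rescale c f + rescale c g"
  by (rule mps_eqI) (simp add: mps_nth_rescale distrib_left)

lemma rescale_diff: "rescale c (f - g) = rescale c f - rescale c g"
  by (rule mps_eqI) (simp add: mps_nth_rescale right_diff_distrib)

lemma rescale_mult: "rescale c (f * g) = rescale c f * rescale c g"
proof (rule mps_eqI)
  fix M
  have "c ^ size M * (mps_nth f A * mps_nth g (M - A))
      = c ^ size A * mps_nth f A * (c ^ size (M - A) * mps_nth g (M - A))" if "A \<subseteq># M" for A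
  proof -
    have "size M = size A + size (M - A)"
      using that by (simp add: size_Diff_submset size_mset_mono)
    then show ?thesis by (simp add: power_add mult_ac)
  qed
  then show "mps_nth (rescale c (f * g)) M = mps_nth (rescale c f * rescale c g) M"
    by (simp add: mps_nth_rescale mps_nth_mult sum_distrib_left)
qed

lemma rescale_one [simp]: "rescale c 1 = 1"
  by (rule mps_eqI) (simp add: mps_nth_rescale mps_nth_one)

lemma restrict_rescale: "restrict_vars d (rescale c f) = rescale c (restrict_vars d f)"
  by (rule mps_eqI) (simp add: mps_nth_rescale mps_nth_restrict)

lemma rescale_order_ge: "f \<in> order_ge k \<Longrightarrow> rescale c f \<in> order_ge k"
  by (simp add: order_ge_def mps_nth_rescale)

lemma rescale_rescale: "rescale a (rescale b f) = rescale (a * b) f"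
  by (rule mps_eqI) (simp add: mps_nth_rescale power_mult_distrib mult_ac)

lemma rescale_1 [simp]: "rescale 1 f = f"
  by (rule mps_eqI) (simp add: mps_nth_rescale)

text \<open>On the homogeneous part of degree \<open>k\<close>, rescaling is multiplication by
  \<open>c ^ k\<close>.\<close>

lemma rescale_lead:
  assumes "f \<in> order_ge k"
  shows "rescale c f - mps_const (c ^ k) * f \<in> order_ge (k + 1)"
  using assms by (auto simp: order_ge_def mps_nth_rescale less_Suc_eq)

lemma filtered_endo_rescale_conj:
  assumes "filtered_endo d u" and "a * b = 1"
  shows "filtered_endo d (\<lambda>f. rescale a (u (rescale b f)))"
proof -
  interpret u: filtered_endo d u by fact
  have "u (rescale b (restrict_vars d f)) = u (rescale b f)" for f
    by (simp add: u.hom_restrict flip: restrict_rescale)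
  then show ?thesis
    by (intro filtered_endoI)
      (simp_all add: rescale_add rescale_mult u.hom_add u.hom_mult u.restrict_hom restrict_rescale
        rescale_order_ge u.hom_order_ge)
qed

lemma filtered_iso_rescale_conj:
  assumes "filtered_iso d u u'" and ab: "a * b = 1"
  shows "filtered_iso d (\<lambda>f. rescale a (u (rescale b f))) (\<lambda>f. rescale a (u' (rescale b f)))"
proof -
  note D = filtered_isoD[OF assms(1)]
  have ba: "b * a = 1" using ab by (simp add: mult.commute)
  show ?thesis
    unfolding filtered_iso_def
    using filtered_endo_rescale_conj[OF D(1) ab] filtered_endo_rescale_conj[OF D(2) ab]
    by (simp add: rescale_rescale ba D(3,4) restrict_rescale ab)
qed

text \<open>Conjugating with \<open>x \<mapsto> b x\<close> multiplies a leading term of degree \<open>n\<close> by \<open>b\<^sup>-\<^sup>n\<close>. For \<open>b = N\<close>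
  the \<open>N\<^sup>n\<^sup>-\<^sup>1\<close>-th power then has leading term \<open>E / N\<close>: this divides \<open>E\<close> by \<open>N\<close> without leaving
  the group, in every characteristic prime to \<open>N\<close>.\<close>

lemma has_lead_rescale_conj:
  assumes u: "has_lead d n u E" and E: "graded_op d n E" and iso: "filtered_iso d u u'"
    and ab: "a * of_nat N = 1"
  shows "has_lead d n (\<lambda>f. rescale a (u (rescale (of_nat N) f))) (\<lambda>f. mps_const (a ^ n) * E f)"
  unfolding has_lead_def
proof (intro allI ballI)
  fix k and f :: "'a mps" assume f: "f \<in> order_ge k"
  interpret E: graded_op d n E by fact
  let ?b = "of_nat N :: 'a"
  have 1: "rescale a (u (rescale ?b f) - restrict_vars d (rescale ?b f) - E (rescale ?b f)) \<in> order_ge (k + n + 1)"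
    by (intro rescale_order_ge has_leadD[OF u] f)
  have "E (rescale ?b f - mps_const (?b ^ k) * f) \<in> order_ge (k + 1 + n)"
    by (intro E.order_ge rescale_lead f)
  moreover have "E (mps_const (?b ^ k) * f) = mps_const (?b ^ k) * E f"
    using E.of_nat_mult[of "N ^ k" f] by (simp flip: mps_const_of_nat of_nat_power)
  ultimately have "E (rescale ?b f) - mps_const (?b ^ k) * E f \<in> order_ge (k + n + 1)"
    by (simp add: E.diff)
  then have 2: "rescale a (E (rescale ?b f) - mps_const (?b ^ k) * E f) \<in> order_ge (k + n + 1)"
    by (rule rescale_order_ge)
  have "mps_const (?b ^ k) * E f \<in> order_ge (k + n)"
    by (intro order_ge_mult_left E.order_ge f)
  then have 3: "rescale a (mps_const (?b ^ k) * E f) - mps_const (a ^ (k + n)) * (mps_const (?b ^ k) * E f)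
      \<in> order_ge (k + n + 1)"
    by (rule rescale_lead)
  \<comment> \<open>The inner rescaling contributes \<open>b ^ k\<close> in degree \<open>k\<close>,
    the outer one \<open>a ^ (k + n)\<close> in degree \<open>k + n\<close>; together this leaves
    \<open>a ^ n\<close>.\<close>
  have "a ^ (k + n) * ?b ^ k = (a * ?b) ^ k * a ^ n"
    by (simp add: power_add power_mult_distrib mult_ac)
  then have "a ^ (k + n) * ?b ^ k = a ^ n"
    by (simp add: ab)
  then have "mps_const (a ^ (k + n)) * (mps_const (?b ^ k) * E f) = mps_const (a ^ n) * E f"
    by (simp flip: mps_const_mult mult.assoc)
  then have "rescale a (u (rescale ?b f)) - restrict_vars d f - mps_const (a ^ n) * E f
      = rescale a (u (rescale ?b f) - restrict_vars d (rescale ?b f) - E (rescale ?b f))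
        + rescale a (E (rescale ?b f) - mps_const (?b ^ k) * E f)
        + (rescale a (mps_const (?b ^ k) * E f) - mps_const (a ^ (k + n)) * (mps_const (?b ^ k) * E f))"
    by (simp add: rescale_diff restrict_rescale rescale_rescale ab)
  then show "rescale a (u (rescale ?b f)) - restrict_vars d f - mps_const (a ^ n) * E f \<in> order_ge (k + n + 1)"
    using 1 2 3 by (metis order_ge_add)
qed

lemma graded_op_const_mult:
  assumes "graded_op d n E"
  shows "graded_op d n (\<lambda>f. mps_const c * E f)"
proof -
  interpret graded_op d n E by fact
  show ?thesis
    by standard (simp_all add: add restrict_vars distrib_left order_ge order_ge_mult_left)
qed

lemma has_lead_divide:
  assumes "n \<ge> 1" and u: "filtered_iso d u u'" "graded_op d n E" "has_lead d n u E"
    and ab: "a * of_nat N = 1"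
  shows "\<exists>b b'. filtered_iso d b b' \<and> has_lead d n b (\<lambda>f. mps_const a * E f)"
proof -
  have "\<exists>b b'. filtered_iso d b b' \<and> has_lead d n b (\<lambda>f. \<Sum>i<N ^ (n - 1). mps_const (a ^ n) * E f)"
    using assms(1) filtered_iso_rescale_conj[OF u(1) ab] graded_op_const_mult[OF u(2)]
      has_lead_rescale_conj[OF u(3,2,1) ab]
    by (intro has_lead_sum[where z = "\<lambda>_ f. rescale a (u (rescale (of_nat N) f))"
          and z' = "\<lambda>_ f. rescale a (u' (rescale (of_nat N) f))"]) simp_all
  \<comment> \<open>The number of factors is chosen for this identity; \<open>n \<ge> 1\<close>
    keeps \<open>n - 1\<close> from being truncated.\<close>
  moreover have "of_nat (N ^ (n - 1)) * a ^ n = a"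
  proof -
    have "a ^ n = a ^ (n - 1) * a" using \<open>n \<ge> 1\<close> by (cases n) auto
    then have "of_nat (N ^ (n - 1)) * a ^ n = (a * of_nat N) ^ (n - 1) * a"
      by (simp add: power_mult_distrib mult_ac)
    then show ?thesis by (simp add: ab)
  qed
  then have "(\<Sum>i<N ^ (n - 1). mps_const (a ^ n) * E f) = mps_const a * E f" for f
    by (simp flip: mps_const_mult mps_const_of_nat mult.assoc)
  ultimately show ?thesis by simp
qed

section \<open>Improving the agreement of two actions by averaging\<close>

locale filtered_action = group G for G (structure) +
  fixes d :: nat and \<alpha> :: "'g \<Rightarrow> 'a::comm_ring_1 mps \<Rightarrow> 'a mps"
  assumes endo: "g \<in> carrier G \<Longrightarrow> filtered_endo d (\<alpha> g)"
    and act_mult: "g \<in> carrier G \<Longrightarrow> h \<in> carrier G \<Longrightarrow> \<alpha> (g \<otimes> h) f = \<alpha> g (\<alpha> h f)"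
    and act_one: "\<alpha> \<one> f = restrict_vars d f"
begin

lemma act_iso: "g \<in> carrier G \<Longrightarrow> filtered_iso d (\<alpha> g) (\<alpha> (inv g))"
  unfolding filtered_iso_def by (auto simp: endo act_one simp flip: act_mult)

end

text \<open>For \<open>n = 1\<close> this says that both actions induce the same action on the
  associated graded ring.\<close>

definition acts_agree :: "('g, 'm) monoid_scheme \<Rightarrow> nat \<Rightarrow> ('g \<Rightarrow> 'a::comm_ring_1 mps \<Rightarrow> 'a mps)
    \<Rightarrow> ('g \<Rightarrow> 'a mps \<Rightarrow> 'a mps) \<Rightarrow> bool" where
  "acts_agree G n \<alpha> \<beta> \<longleftrightarrow>
    (\<forall>g\<in>carrier G. \<forall>k. \<forall>f\<in>order_ge k. \<alpha> g f - \<beta> g f \<in> order_ge (k + n))"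

text \<open>A filtered endomorphism need not fix the scalars, but it fixes integers and therefore
  their inverses.\<close>

lemma fixes_inverse:
  assumes "filtered_endo d u" and a: "a * of_nat N = 1"
  shows "u (mps_const a) = mps_const a"
proof -
  interpret u: filtered_endo d u by fact
  have *: "mps_const a * of_nat N = 1"
    using a by (simp flip: mps_const_of_nat mps_const_mult)
  then have "u (mps_const a) * of_nat N = 1"
    by (metis u.hom_mult u.hom_of_nat u.hom_one)
  then have "u (mps_const a) = u (mps_const a) * (mps_const a * of_nat N)"
    by (simp add: *)
  also have "\<dots> = (u (mps_const a) * of_nat N) * mps_const a"
    by (simp only: mult_ac)
  finally show ?thesis
    using \<open>u (mps_const a) * of_nat N = 1\<close> by simp
qed

text \<open>Write \<open>z_h = \<alpha>_h \<phi>_h^-1 = 1 + E_h\<close> and let \<open>B\<close> be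
  the average of the \<open>E_h\<close>. Summing the cocycle relation gives
  \<open>B \<phi>_g = \<phi>_g B + \<alpha>_g - \<phi>_g\<close> up to terms raising the order by
  \<open>n + 1\<close>. So \<open>\<alpha>_g b\<close> and \<open>b \<phi>_g\<close> agree one order
  further if \<open>b\<close> has leading term \<open>B\<close>.\<close>

lemma acts_agree_improve:
  fixes G :: "('g, 'm) monoid_scheme" and \<alpha> \<phi> :: "'g \<Rightarrow> 'l::comm_ring_1 mps \<Rightarrow> 'l mps"
    and a :: 'l
  assumes "filtered_action G d \<alpha>" "filtered_action G d \<phi>" "finite (carrier G)"
    and a: "a * of_nat (card (carrier G)) = 1"
    and "n \<ge> 1" and agree: "acts_agree G n \<alpha> \<phi>"
  shows "\<exists>b b'. filtered_iso d b b' \<and> (\<forall>k. \<forall>f\<in>order_ge k. b f - restrict_vars d f \<in> order_ge (k + n))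
    \<and> acts_agree G (n + 1) (\<lambda>g f. b' (\<alpha> g (b f))) \<phi>"
proof -
  interpret \<alpha>: filtered_action G d \<alpha> by fact
  interpret \<phi>: filtered_action G d \<phi> by fact
  note agreeD = agree[unfolded acts_agree_def, rule_format]
  let ?G = "carrier G"
  define z where "z h f = \<alpha> h (\<phi> (inv\<^bsub>G\<^esub> h) f)" for h f
  define z' where "z' h f = \<phi> h (\<alpha> (inv\<^bsub>G\<^esub> h) f)" for h f
  define E where "E h f = z h f - restrict_vars d f" for h f
  define S where "S f = (\<Sum>h\<in>?G. E h f)" for f
  have z: "filtered_iso d (z h) (z' h)" if "h \<in> ?G" for h
    using filtered_iso_comp[OF \<alpha>.act_iso[OF that] \<phi>.act_iso[of "inv\<^bsub>G\<^esub> h"]] that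
    by (simp add: z_def[abs_def] z'_def[abs_def])
  have E: "graded_op d n (E h)" if h: "h \<in> ?G" for h
  proof
    interpret z: filtered_endo d "z h" by (rule filtered_isoD(1)[OF z[OF h]])
    show "E h (f + g) = E h f + E h g" for f g
      by (simp add: E_def z.hom_add restrict_add)
    show "E h (restrict_vars d f) = E h f" for f
      by (simp add: E_def z.hom_restrict)
    show "E h f \<in> order_ge (k + n)" if f: "f \<in> order_ge k" for f k
    proof -
      have "\<phi> (inv\<^bsub>G\<^esub> h) f \<in> order_ge k"
        using h f by (intro filtered_endo.hom_order_ge[OF \<phi>.endo]) auto
      from agreeD[OF h this] show ?thesis
        using h by (simp add: E_def z_def \<phi>.act_one flip: \<phi>.act_mult)
    qed
  qed
  have lead: "has_lead d n (z h) (E h)" for h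
    by (simp add: has_lead_def E_def)
  have S: "graded_op d n S"
    unfolding S_def[abs_def] by (rule graded_op_sum) (rule E)
  have "\<exists>u u'. filtered_iso d u u' \<and> has_lead d n u S"
    unfolding S_def[abs_def] by (rule has_lead_sum[OF assms(3) \<open>n \<ge> 1\<close> z E lead])
  then obtain u u' where u: "filtered_iso d u u'" "has_lead d n u S"
    by blast
  from has_lead_divide[OF \<open>n \<ge> 1\<close> u(1) S u(2) a] obtain b b'
    where b: "filtered_iso d b b'" "has_lead d n b (\<lambda>f. mps_const a * S f)" by blast
  interpret b: filtered_endo d b by (rule filtered_isoD(1)[OF b(1)])
  interpret b': filtered_endo d b' by (rule filtered_isoD(2)[OF b(1)])
  let ?B = "\<lambda>f. mps_const a * S f"
  have B: "graded_op d n ?B" by (rule graded_op_const_mult[OF S])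
  have diff: "b f - restrict_vars d f \<in> order_ge (k + n)" if "f \<in> order_ge k" for f k
    by (rule has_lead_diff_restrict[OF b(2) B that])
  have "b' (\<alpha> g (b f)) - \<phi> g f \<in> order_ge (k + n + 1)" if g: "g \<in> ?G" and f: "f \<in> order_ge k" for g k f
  proof -
    interpret \<alpha>g: filtered_endo d "\<alpha> g" by (rule \<alpha>.endo[OF g])
    interpret \<phi>g: filtered_endo d "\<phi> g" by (rule \<phi>.endo[OF g])
    interpret B: graded_op d n ?B by (rule B)
    \<comment> \<open>Second-order errors raise the order by \<open>2n\<close>, which suffices
      because \<open>n \<ge> 1\<close>.\<close>
    have up: "x \<in> order_ge (k + n + 1)" if "x \<in> order_ge (k + n + n)" for x :: "'l mps"
      using that by (rule order_ge_mono) (use \<open>n \<ge> 1\<close> in simp)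
    let ?y = "\<phi> g f"
    have 1: "\<alpha> g (b f - restrict_vars d f - ?B f) \<in> order_ge (k + n + 1)"
      by (intro \<alpha>g.hom_order_ge has_leadD[OF b(2) f])
    have 2: "\<alpha> g (?B f) - \<phi> g (?B f) \<in> order_ge (k + n + 1)"
      by (intro up agreeD g B.order_ge f)
    have 3: "b ?y - restrict_vars d ?y - ?B ?y \<in> order_ge (k + n + 1)"
      by (intro has_leadD[OF b(2)] \<phi>g.hom_order_ge f)
    \<comment> \<open>The cocycle relation: expanding both actions at the product of
      \<open>g\<close> and \<open>h\<close> leaves the error
      \<open>(\<alpha>_g - \<phi>_g) (E_h f)\<close>, which is of second order.\<close>
    have shift: "E (g \<otimes>\<^bsub>G\<^esub> h) ?y - (\<phi> g (E h f) + (\<alpha> g f - ?y)) \<in> order_ge (k + n + 1)"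
      if h: "h \<in> ?G" for h
    proof -
      have "\<phi> (inv\<^bsub>G\<^esub> g) ?y = restrict_vars d f"
        using g by (simp add: \<phi>.act_one flip: \<phi>.act_mult)
      moreover have "\<phi> (inv\<^bsub>G\<^esub> h) (restrict_vars d f) = \<phi> (inv\<^bsub>G\<^esub> h) f"
        using h by (intro filtered_endo.hom_restrict[OF \<phi>.endo]) simp
      ultimately have "E (g \<otimes>\<^bsub>G\<^esub> h) ?y = \<alpha> g (z h f) - ?y"
        using g h by (simp add: E_def z_def \<alpha>.act_mult \<phi>.act_mult \<alpha>.inv_mult_group \<phi>g.restrict_hom)
      then have "E (g \<otimes>\<^bsub>G\<^esub> h) ?y - (\<phi> g (E h f) + (\<alpha> g f - ?y)) = \<alpha> g (E h f) - \<phi> g (E h f)"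
        by (simp add: E_def \<alpha>g.hom_minus \<alpha>g.hom_restrict)
      then show ?thesis
        using up[OF agreeD[OF g graded_op.order_ge[OF E[OF h] f]]] by (simp only:)
    qed
    \<comment> \<open>Left translation by \<open>g\<close> permutes the group. Hence summing
      \<open>shift\<close> over \<open>h\<close> produces \<open>S\<close> again, while the term
      without \<open>h\<close> occurs \<open>|G|\<close> times and is normalized by
      \<open>a\<close>.\<close>
    have "(\<Sum>h\<in>?G. E (g \<otimes>\<^bsub>G\<^esub> h) ?y) = S ?y"
      unfolding S_def
      using sum.reindex[OF \<alpha>.inj_on_cmult[OF g], of "\<lambda>h. E h ?y"] \<alpha>.surj_const_mult[OF g]
      by simp
    then have "S ?y - (\<phi> g (S f) + of_nat (card ?G) * (\<alpha> g f - ?y))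
        = (\<Sum>h\<in>?G. E (g \<otimes>\<^bsub>G\<^esub> h) ?y - (\<phi> g (E h f) + (\<alpha> g f - ?y)))"
      by (simp add: sum_subtractf sum.distrib S_def \<phi>g.hom_sum right_diff_distrib)
    also have "\<dots> \<in> order_ge (k + n + 1)"
      by (intro order_ge_sum shift)
    finally have "mps_const a * (S ?y - (\<phi> g (S f) + of_nat (card ?G) * (\<alpha> g f - ?y)))
        \<in> order_ge (k + n + 1)"
      by (rule order_ge_mult_left)
    also have "mps_const a * (S ?y - (\<phi> g (S f) + of_nat (card ?G) * (\<alpha> g f - ?y)))
        = ?B ?y - mps_const a * \<phi> g (S f) - mps_const a * of_nat (card ?G) * (\<alpha> g f - ?y)"
      by (simp add: algebra_simps)
    also have "mps_const a * of_nat (card ?G) = (1 :: 'l mps)"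
      by (simp add: a flip: mps_const_of_nat mps_const_mult)
    also have "mps_const a * \<phi> g (S f) = \<phi> g (?B f)"
      using fixes_inverse[OF \<phi>.endo[OF g] a] by (simp add: \<phi>g.hom_mult)
    finally have "- (?B ?y - \<phi> g (?B f) - 1 * (\<alpha> g f - ?y)) \<in> order_ge (k + n + 1)"
      by (rule order_ge_uminus)
    then have "\<alpha> g f - ?y + \<phi> g (?B f) - ?B ?y \<in> order_ge (k + n + 1)"
      by (simp add: algebra_simps)
    \<comment> \<open>By \<open>1\<close> and \<open>2\<close>, \<open>\<alpha> g (b f)\<close>
      becomes \<open>\<alpha> g f + \<phi> g (B f)\<close>; by \<open>3\<close>, \<open>b ?y\<close>
      becomes \<open>?y + B ?y\<close>. The averaged relation cancels what remains.\<close>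
    from order_ge_diff[OF order_ge_add[OF order_ge_add[OF 1 2] this] 3]
    have "\<alpha> g (b f) - b ?y \<in> order_ge (k + n + 1)"
      by (simp add: \<alpha>g.hom_minus \<alpha>g.hom_restrict \<phi>g.restrict_hom)
    then have "b' (\<alpha> g (b f) - b ?y) \<in> order_ge (k + n + 1)"
      by (rule b'.hom_order_ge)
    then show ?thesis
      by (simp add: b'.hom_minus filtered_isoD(4)[OF b(1)] \<phi>g.restrict_hom)
  qed
  then have "acts_agree G (n + 1) (\<lambda>g f. b' (\<alpha> g (b f))) \<phi>"
    by (simp add: acts_agree_def)
  with diff b(1) show ?thesis by blast
qed

section \<open>Conjugating two actions with the same graded action\<close>

text \<open>The limit is taken pointwise. Each law holds for every \<open>u n\<close>, so it holds
  for the limit modulo every order, hence exactly.\<close>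

lemma filtered_endo_limit:
  assumes u: "\<And>n. filtered_endo d (u n)" and step: "\<And>n f. u (Suc n) f - u n f \<in> order_ge n"
  obtains l where "filtered_endo d l" "\<And>n f. l f - u n f \<in> order_ge n"
proof -
  have "\<exists>y. \<forall>n. y - u n f \<in> order_ge n" for f
    by (rule order_ge_complete[of "\<lambda>n. u n f"]) (use step in blast)+
  then obtain l where l: "\<And>n f. l f - u n f \<in> order_ge n" by metis
  have "filtered_endo d l"
  proof (rule filtered_endoI)
    fix f g
    show "l (f + g) = l f + l g"
    proof (rule mps_eqI_order_ge)
      fix n
      interpret filtered_endo d "u n" by (rule u)
      have "l (f + g) - (l f + l g) = (l (f + g) - u n (f + g)) - (l f - u n f) - (l g - u n g)"
        by (simp add: hom_add)
      then show "l (f + g) - (l f + l g) \<in> order_ge n"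
        by (simp only: order_ge_diff l)
    qed
    show "l (f * g) = l f * l g"
    proof (rule mps_eqI_order_ge)
      fix n
      interpret filtered_endo d "u n" by (rule u)
      have "l (f * g) - l f * l g
          = (l (f * g) - u n (f * g)) - l f * (l g - u n g) - u n g * (l f - u n f)"
        by (simp add: hom_mult algebra_simps)
      then show "l (f * g) - l f * l g \<in> order_ge n"
        by (simp only: order_ge_diff order_ge_mult_left l)
    qed
  next
    show "l 1 = 1"
    proof (rule mps_eqI_order_ge)
      fix n
      interpret filtered_endo d "u n" by (rule u)
      show "l 1 - 1 \<in> order_ge n" using l[of 1 n] by simp
    qed
  next
    fix f
    show "l (restrict_vars d f) = l f"
    proof (rule mps_eqI_order_ge)
      fix n
      interpret filtered_endo d "u n" by (rule u)
      have "l (restrict_vars d f) - l f = (l (restrict_vars d f) - u n (restrict_vars d f)) - (l f - u n f)"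
        by (simp add: hom_restrict)
      then show "l (restrict_vars d f) - l f \<in> order_ge n"
        by (simp only: order_ge_diff l)
    qed
    show "restrict_vars d (l f) = l f"
    proof (rule mps_eqI_order_ge)
      fix n
      interpret filtered_endo d "u n" by (rule u)
      have "restrict_vars d (l f) = restrict_vars d (l f - u n f) + u n f"
        using restrict_add[of d "l f - u n f" "u n f"] by (simp add: restrict_hom)
      then have "restrict_vars d (l f) - l f = restrict_vars d (l f - u n f) - (l f - u n f)" by simp
      then show "restrict_vars d (l f) - l f \<in> order_ge n"
        by (simp only: order_ge_diff order_ge_restrict l)
    qed
  next
    fix f :: "'a mps" and k assume "f \<in> order_ge k"
    \<comment> \<open>One member of the sequence suffices: \<open>u k f\<close> differs from
      \<open>l f\<close> by order at least \<open>k\<close>.\<close>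
    then have "u k f \<in> order_ge k" by (rule filtered_endo.hom_order_ge[OF u])
    from order_ge_add[OF l[of f k] this] show "l f \<in> order_ge k" by simp
  qed
  then show ?thesis using l that by blast
qed

lemma filtered_action_conj:
  assumes "filtered_action G d \<alpha>" and iso: "filtered_iso d u u'"
  shows "filtered_action G d (\<lambda>g f. u' (\<alpha> g (u f)))"
proof -
  interpret filtered_action G d \<alpha> by fact
  note D = filtered_isoD[OF iso]
  interpret u: filtered_endo d u by (rule D)
  show ?thesis
  proof (intro filtered_action.intro filtered_action_axioms.intro group_axioms)
    show "filtered_endo d (\<lambda>f. u' (\<alpha> g (u f)))" if "g \<in> carrier G" for g
      by (rule filtered_endo_comp[OF D(2) filtered_endo_comp[OF endo[OF that] D(1)]])
    show "u' (\<alpha> (g \<otimes>\<^bsub>G\<^esub> h) (u f)) = u' (\<alpha> g (u (u' (\<alpha> h (u f)))))"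
      if "g \<in> carrier G" "h \<in> carrier G" for g h f
      using that endo by (simp add: D act_mult filtered_endo.restrict_hom)
    show "u' (\<alpha> \<one>\<^bsub>G\<^esub> (u f)) = restrict_vars d f" for f
      by (simp add: act_one u.restrict_hom D)
  qed
qed

text \<open>The corrections are composed on the right. The \<open>n\<close>-th one differs from the
  identity by terms raising the order by \<open>n + 1\<close>, so the products and their inverses
  both converge, and in the limit the actions agree to every order.\<close>

lemma filtered_actions_conjugate:
  fixes G :: "('g, 'm) monoid_scheme" and \<alpha> \<phi> :: "'g \<Rightarrow> 'l::comm_ring_1 mps \<Rightarrow> 'l mps"
    and a :: 'l
  assumes \<alpha>: "filtered_action G d \<alpha>" and \<phi>: "filtered_action G d \<phi>" and "finite (carrier G)"
    and a: "a * of_nat (card (carrier G)) = 1"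
    and agree: "acts_agree G 1 \<alpha> \<phi>"
  obtains \<theta> \<theta>' where "filtered_iso d \<theta> \<theta>'"
    "\<And>g f. g \<in> carrier G \<Longrightarrow> \<alpha> g (\<theta> f) = \<theta> (\<phi> g f)"
proof -
  \<comment> \<open>The index is shifted because the approximation starts from agreement to order
    \<open>1\<close>. \<open>Q\<close> is the Cauchy condition for the product and for its
    inverse.\<close>
  define P where "P n t \<longleftrightarrow> filtered_iso d (fst t) (snd t)
      \<and> acts_agree G (n + 1) (\<lambda>g f. snd t (\<alpha> g (fst t f))) \<phi>"
    for n :: nat and t :: "('l mps \<Rightarrow> 'l mps) \<times> ('l mps \<Rightarrow> 'l mps)"
  define Q where "Q n t s \<longleftrightarrow> (\<forall>f. fst s f - fst t f \<in> order_ge n \<and> snd s f - snd t f \<in> order_ge n)"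
    for n :: nat and t s :: "('l mps \<Rightarrow> 'l mps) \<times> ('l mps \<Rightarrow> 'l mps)"
  have "\<exists>T. \<forall>n. P n (T n) \<and> Q n (T n) (T (Suc n))"
  proof (rule dependent_nat_choice)
    have "restrict_vars d (\<alpha> g (restrict_vars d f)) = \<alpha> g f" if "g \<in> carrier G" for g f
      using filtered_action.endo[OF \<alpha> that] by (simp add: filtered_endo.restrict_hom filtered_endo.hom_restrict)
    then have "P 0 (restrict_vars d, restrict_vars d)"
      using agree by (simp add: P_def filtered_iso_restrict acts_agree_def)
    then show "\<exists>t. P 0 t" by blast
  next
    fix t and n :: nat assume "P n t"
    then have t: "filtered_iso d (fst t) (snd t)"
      and ag: "acts_agree G (n + 1) (\<lambda>g f. snd t (\<alpha> g (fst t f))) \<phi>"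
      by (auto simp: P_def)
    have "\<exists>b b'. filtered_iso d b b'
        \<and> (\<forall>k. \<forall>f\<in>order_ge k. b f - restrict_vars d f \<in> order_ge (k + (n + 1)))
        \<and> acts_agree G (n + 1 + 1) (\<lambda>g f. b' (snd t (\<alpha> g (fst t (b f))))) \<phi>"
      by (rule acts_agree_improve[OF filtered_action_conj[OF \<alpha> t] \<phi> assms(3) a _ ag]) simp
    then obtain b b' where b: "filtered_iso d b b'"
      and near: "\<And>f k. f \<in> order_ge k \<Longrightarrow> b f - restrict_vars d f \<in> order_ge (k + (n + 1))"
      and ag': "acts_agree G (n + 1 + 1) (\<lambda>g f. b' (snd t (\<alpha> g (fst t (b f))))) \<phi>"
      by blast
    interpret t: filtered_endo d "fst t" by (rule filtered_isoD(1)[OF t])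
    interpret t': filtered_endo d "snd t" by (rule filtered_isoD(2)[OF t])
    interpret b': filtered_endo d b' by (rule filtered_isoD(2)[OF b])
    have near': "b f - restrict_vars d f \<in> order_ge n" for f
      using near[of f 0] by (auto intro: order_ge_mono)
    have "fst t (b f) - fst t f \<in> order_ge n" for f
      using t.hom_order_ge[OF near'[of f]] by (simp add: t.hom_minus t.hom_restrict)
    moreover have "b' (snd t f) - snd t f \<in> order_ge n" for f
    proof -
      \<comment> \<open>For \<open>x = snd t f\<close>, applying \<open>b'\<close> to
        \<open>x - b x\<close> gives \<open>b' x - x\<close>.\<close>
      have "b' (- (b (snd t f) - restrict_vars d (snd t f))) \<in> order_ge n"
        by (intro b'.hom_order_ge order_ge_uminus near')
      then show ?thesis
        by (simp add: b'.hom_minus b'.hom_restrict filtered_isoD(4)[OF b] t'.restrict_hom)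
    qed
    ultimately have "Q n t (\<lambda>f. fst t (b f), \<lambda>f. b' (snd t f))"
      by (simp add: Q_def)
    moreover have "P (Suc n) (\<lambda>f. fst t (b f), \<lambda>f. b' (snd t f))"
      using filtered_iso_comp[OF t b] ag' by (simp add: P_def)
    ultimately show "\<exists>s. P (Suc n) s \<and> Q n t s" by blast
  qed
  then obtain T where P: "\<And>n. P n (T n)" and Q: "\<And>n. Q n (T n) (T (Suc n))" by blast
  have iso: "filtered_iso d (fst (T n)) (snd (T n))" for n
    using P[of n] by (simp add: P_def)
  obtain \<theta> where \<theta>: "filtered_endo d \<theta>" "\<And>n f. \<theta> f - fst (T n) f \<in> order_ge n"
    by (rule filtered_endo_limit[of d "\<lambda>n. fst (T n)"])
      (use filtered_isoD(1)[OF iso] Q in \<open>auto simp: Q_def\<close>)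
  obtain \<theta>' where \<theta>': "filtered_endo d \<theta>'" "\<And>n f. \<theta>' f - snd (T n) f \<in> order_ge n"
    by (rule filtered_endo_limit[of d "\<lambda>n. snd (T n)"])
      (use filtered_isoD(2)[OF iso] Q in \<open>auto simp: Q_def\<close>)
  interpret \<theta>: filtered_endo d \<theta> by (rule \<theta>(1))
  interpret \<theta>': filtered_endo d \<theta>' by (rule \<theta>'(1))
  have "\<theta> (\<theta>' f) = restrict_vars d f" for f
  proof (rule mps_eqI_order_ge)
    fix n
    interpret t: filtered_endo d "fst (T n)" by (rule filtered_isoD(1)[OF iso])
    from order_ge_add[OF \<theta>(2)[of "\<theta>' f" n] t.hom_order_ge[OF \<theta>'(2)[of f n]]]
    show "\<theta> (\<theta>' f) - restrict_vars d f \<in> order_ge n"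
      by (simp add: t.hom_minus filtered_isoD(3)[OF iso])
  qed
  moreover have "\<theta>' (\<theta> f) = restrict_vars d f" for f
  proof (rule mps_eqI_order_ge)
    fix n
    interpret t: filtered_endo d "snd (T n)" by (rule filtered_isoD(2)[OF iso])
    from order_ge_add[OF \<theta>'(2)[of "\<theta> f" n] t.hom_order_ge[OF \<theta>(2)[of f n]]]
    show "\<theta>' (\<theta> f) - restrict_vars d f \<in> order_ge n"
      by (simp add: t.hom_minus filtered_isoD(4)[OF iso])
  qed
  ultimately have "filtered_iso d \<theta> \<theta>'"
    using \<theta>(1) \<theta>'(1) by (simp add: filtered_iso_def)
  moreover have "\<alpha> g (\<theta> f) = \<theta> (\<phi> g f)" if g: "g \<in> carrier G" for g f
  proof (rule mps_eqI_order_ge)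
    fix n
    interpret t: filtered_endo d "fst (T n)" by (rule filtered_isoD(1)[OF iso])
    interpret \<alpha>g: filtered_endo d "\<alpha> g" by (rule filtered_action.endo[OF \<alpha> g])
    have "snd (T n) (\<alpha> g (fst (T n) f)) - \<phi> g f \<in> order_ge (0 + (n + 1))"
      using P[of n] g unfolding P_def acts_agree_def by (meson order_ge_0)
    then have "snd (T n) (\<alpha> g (fst (T n) f)) - \<phi> g f \<in> order_ge n"
      by (rule order_ge_mono) simp
    then have 1: "\<alpha> g (fst (T n) f) - fst (T n) (\<phi> g f) \<in> order_ge n"
      using t.hom_order_ge by (fastforce simp: t.hom_minus filtered_isoD(3)[OF iso] \<alpha>g.restrict_hom)
    from order_ge_diff[OF order_ge_add[OF \<alpha>g.hom_order_ge[OF \<theta>(2)[of f n]] 1] \<theta>(2)[of "\<phi> g f" n]]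
    show "\<alpha> g (\<theta> f) - \<theta> (\<phi> g f) \<in> order_ge n"
      by (simp add: \<alpha>g.hom_minus)
  qed
  ultimately show ?thesis by (rule that)
qed

section \<open>The associated graded action\<close>

lemma mps_eqI_hom_part:
  assumes "\<And>k. hom_part k f = hom_part k g"
  shows "f = g"
proof (rule mps_eqI)
  fix M
  show "mps_nth f M = mps_nth g M"
    using arg_cong[OF assms[of "size M"], of "\<lambda>f. mps_nth f M"] by (simp add: mps_nth_hom_part)
qed

lemma hom_part_eq_0: "f \<in> order_ge n \<Longrightarrow> k < n \<Longrightarrow> hom_part k f = 0"
  by (rule mps_eqI) (auto simp: mps_nth_hom_part order_geD)

lemma hom_part_zero [simp]: "hom_part k 0 = 0"
  by (rule mps_eqI) (simp add: mps_nth_hom_part)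

lemma hom_part_diff: "hom_part k (f - g) = hom_part k f - hom_part k g"
  by (rule mps_eqI) (simp add: mps_nth_hom_part)

lemma hom_part_sum: "hom_part k (\<Sum>i\<in>I. f i) = (\<Sum>i\<in>I. hom_part k (f i))"
  by (rule mps_eqI) (simp add: mps_nth_hom_part)

lemma hom_part_one: "hom_part k 1 = (if k = 0 then 1 else 0)"
  by (rule mps_eqI) (auto simp: mps_nth_hom_part mps_nth_one)

text \<open>A series has no homogeneous parts below its order, so only the splitting into
  \<open>i\<close> and \<open>j\<close> survives in the convolution.\<close>

lemma hom_part_mult_lead:
  assumes "f \<in> order_ge i" "g \<in> order_ge j"
  shows "hom_part (i + j) (f * g) = hom_part i f * hom_part j g"
proof -
  have "hom_part l f * hom_part (i + j - l) g = (if l = i then hom_part i f * hom_part j g else 0)"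
    if "l \<le> i + j" for l
    using that hom_part_eq_0[OF assms(1), of l] hom_part_eq_0[OF assms(2), of "i + j - l"]
    by (cases l i rule: linorder_cases) auto
  then have "hom_part (i + j) (f * g) = (\<Sum>l\<le>i + j. if l = i then hom_part i f * hom_part j g else 0)"
    unfolding hom_part_mult by (intro sum.cong) auto
  then show ?thesis by simp
qed

text \<open>The endomorphism of the associated graded ring, completed to an endomorphism of the power
  series ring.\<close>

definition gr :: "('a::comm_ring_1 mps \<Rightarrow> 'a mps) \<Rightarrow> 'a mps \<Rightarrow> 'a mps" where
  "gr u f = Abs_mps (\<lambda>M. mps_nth (u (hom_part (size M) f)) M)"

lemma hom_part_gr: "hom_part k (gr u f) = hom_part k (u (hom_part k f))"
  by (rule mps_eqI) (simp add: mps_nth_hom_part gr_def)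

text \<open>For multiplicativity, \<open>u\<close> sends parts of degrees \<open>i\<close> and
  \<open>k - i\<close> to series of at least these orders, so degree \<open>k\<close> of the product
  sees only the leading parts of the factors.\<close>

lemma filtered_endo_gr:
  assumes "filtered_endo d u"
  shows "filtered_endo d (gr u)"
proof -
  interpret filtered_endo d u by fact
  have lead: "u (hom_part k f) \<in> order_ge k" for k f
    by (intro hom_order_ge hom_part_order_ge)
  show ?thesis
  proof (rule filtered_endoI)
    fix f g :: "'a mps"
    show "gr u (f + g) = gr u f + gr u g"
      by (rule mps_eqI_hom_part) (simp add: hom_part_gr hom_part_add hom_add)
    show "gr u (f * g) = gr u f * gr u g"
    proof (rule mps_eqI_hom_part)
      fix k
      have "hom_part k (gr u (f * g))
          = (\<Sum>i\<le>k. hom_part (i + (k - i)) (u (hom_part i f) * u (hom_part (k - i) g)))"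
        unfolding hom_part_gr hom_part_mult[of k f g]
        by (simp add: hom_sum hom_mult hom_part_sum)
      also have "\<dots> = (\<Sum>i\<le>k. hom_part i (gr u f) * hom_part (k - i) (gr u g))"
        by (simp only: hom_part_mult_lead[OF lead lead] hom_part_gr)
      finally show "hom_part k (gr u (f * g)) = hom_part k (gr u f * gr u g)"
        by (simp only: hom_part_mult)
    qed
  next
    show "gr u 1 = 1"
      by (rule mps_eqI_hom_part) (simp add: hom_part_gr hom_part_one)
  next
    fix f
    show "gr u (restrict_vars d f) = gr u f"
      by (rule mps_eqI_hom_part) (simp add: hom_part_gr hom_part_restrict hom_restrict)
    show "restrict_vars d (gr u f) = gr u f"
    proof (rule mps_eqI_hom_part)
      fix k
      show "hom_part k (restrict_vars d (gr u f)) = hom_part k (gr u f)"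
        unfolding hom_part_restrict hom_part_gr by (simp add: restrict_hom flip: hom_part_restrict)
    qed
  next
    fix f :: "'a mps" and k assume f: "f \<in> order_ge k"
    show "gr u f \<in> order_ge k"
      using hom_part_eq_0[OF f] by (simp add: order_ge_def gr_def)
  qed
qed

lemma gr_restrict: "gr (restrict_vars d) f = restrict_vars d f"
  by (rule mps_eqI_hom_part) (simp add: hom_part_gr hom_part_hom_part flip: hom_part_restrict)

text \<open>Terms of \<open>v (hom_part k f)\<close> above degree \<open>k\<close> are sent by
  \<open>u\<close> above degree \<open>k\<close>, so they do not reach the degree \<open>k\<close>
  part.\<close>

lemma gr_comp:
  assumes "filtered_endo d u" "filtered_endo d v"
  shows "gr (\<lambda>f. u (v f)) f = gr u (gr v f)"
proof (rule mps_eqI_hom_part)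
  fix k
  interpret u: filtered_endo d u by fact
  interpret v: filtered_endo d v by fact
  let ?x = "v (hom_part k f)"
  have "u (?x - hom_part k ?x) \<in> order_ge (Suc k)"
    by (intro u.hom_order_ge diff_hom_part_order_ge v.hom_order_ge hom_part_order_ge)
  then have "hom_part k (u (?x - hom_part k ?x)) = 0"
    by (rule hom_part_eq_0) simp
  then show "hom_part k (gr (\<lambda>f. u (v f)) f) = hom_part k (gr u (gr v f))"
    by (simp add: hom_part_gr u.hom_minus hom_part_diff)
qed

text \<open>In degree \<open>k\<close>, the lowest possible one, both maps depend only on the degree
  \<open>k\<close> part of \<open>f\<close> and agree there by construction.\<close>

lemma diff_gr_order_ge:
  assumes "filtered_endo d u" "f \<in> order_ge k"
  shows "u f - gr u f \<in> order_ge (k + 1)"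
proof -
  interpret filtered_endo d u by fact
  interpret gr: filtered_endo d "gr u" by (rule filtered_endo_gr) fact
  let ?x = "u f - gr u f"
  have "u (f - hom_part k f) \<in> order_ge (Suc k)"
    by (intro hom_order_ge diff_hom_part_order_ge assms)
  then have "hom_part k (u (f - hom_part k f)) = 0"
    by (rule hom_part_eq_0) simp
  then have "hom_part k ?x = 0"
    by (simp add: hom_part_diff hom_part_gr hom_minus)
  moreover have "?x - hom_part k ?x \<in> order_ge (Suc k)"
    by (intro diff_hom_part_order_ge order_ge_diff hom_order_ge gr.hom_order_ge assms)
  ultimately show ?thesis by simp
qed

lemma filtered_action_gr:
  assumes "filtered_action G d \<alpha>"
  shows "filtered_action G d (\<lambda>g. gr (\<alpha> g))"
proof -
  interpret filtered_action G d \<alpha> by fact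
  have "\<alpha> (g \<otimes>\<^bsub>G\<^esub> h) = (\<lambda>f. \<alpha> g (\<alpha> h f))" if "g \<in> carrier G" "h \<in> carrier G" for g h
    using that by (simp add: fun_eq_iff act_mult)
  moreover have "\<alpha> \<one>\<^bsub>G\<^esub> = restrict_vars d" by (simp add: fun_eq_iff act_one)
  ultimately show ?thesis
    by (intro filtered_action.intro filtered_action_axioms.intro group_axioms)
      (simp_all add: filtered_endo_gr endo gr_restrict gr_comp[OF endo endo])
qed

lemma acts_agree_gr: "filtered_action G d \<alpha> \<Longrightarrow> acts_agree G 1 \<alpha> (\<lambda>g. gr (\<alpha> g))"
  by (simp add: acts_agree_def diff_gr_order_ge[OF filtered_action.endo] flip: One_nat_def)

text \<open>Each monomial is divided by its least variable, so it is counted in exactly one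
  summand.\<close>

lemma sum_var_mult_decomposition:
  assumes "f \<in> order_ge (Suc k)" "restrict_vars d f = f"
  obtains q where "f = (\<Sum>j<d. mps_var j * q j)" "\<And>j. q j \<in> order_ge k"
proof
  define q where
    "q j = Abs_mps (\<lambda>M. if \<forall>i\<in>#M. j \<le> i then mps_nth f (add_mset j M) else 0)" for j
  show "q j \<in> order_ge k" for j
    using assms(1) by (auto simp: q_def order_ge_def)
  show "f = (\<Sum>j<d. mps_var j * q j)"
  proof (rule mps_eqI)
    fix M
    have eq: "mps_nth (mps_var j * q j) M
        = (if j \<in># M \<and> (\<forall>i\<in>#M. j \<le> i) then mps_nth f M else 0)" for j
    proof (cases "j \<in># M")
      case True
      have "(\<forall>i\<in>#M - {#j#}. j \<le> i) \<longleftrightarrow> (\<forall>i\<in>#M. j \<le> i)"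
        using True by (metis insert_DiffM insert_iff order_refl set_mset_add_mset_insert)
      then show ?thesis using True
        by (simp add: mps_var_eq_monom mps_nth_monom_mult q_def)
    qed (simp add: mps_var_eq_monom mps_nth_monom_mult)
    show "mps_nth f M = mps_nth (\<Sum>j<d. mps_var j * q j) M"
    proof (cases "M = {#} \<or> \<not> set_mset M \<subseteq> {..<d}")
      case True
      then have "mps_nth f M = 0"
        using order_geD[OF assms(1), of M] mps_nth_restrict[of d f M] assms(2) by (auto split: if_splits)
      then show ?thesis by (simp add: eq cong: if_cong)
    next
      case False
      define m where "m = Min (set_mset M)"
      have m: "m \<in># M" "\<And>i. i \<in># M \<Longrightarrow> m \<le> i"
        using False by (auto simp: m_def)
      have "(j \<in># M \<and> (\<forall>i\<in>#M. j \<le> i)) \<longleftrightarrow> j = m" for j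
        using m by (auto intro: antisym)
      moreover have "m < d" using m False by auto
      ultimately show ?thesis by (simp add: eq)
    qed
  qed
qed

text \<open>An element of positive order is a nonunit, and this is preserved by automorphisms.\<close>

lemma ring_automorphism_filtered:
  fixes u v :: "'a::field mps \<Rightarrow> 'a mps"
  assumes "comm_ring_hom u" "comm_ring_hom v"
    and u_restrict: "\<And>f. u (restrict_vars d f) = u f" and v_u: "\<And>f. v (u f) = restrict_vars d f"
  shows "f \<in> order_ge k \<Longrightarrow> u f \<in> order_ge k"
proof -
  interpret u: comm_ring_hom u by fact
  interpret v: comm_ring_hom v by fact
  have 1: "u f \<in> order_ge 1" if f: "f \<in> order_ge 1" for f
  proof (rule ccontr)
    assume "u f \<notin> order_ge 1"
    then have "mps_nth (u f) {#} \<noteq> 0" by (auto simp: order_ge_def)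
    \<comment> \<open>A nonzero constant term makes \<open>u f\<close> a unit; \<open>v\<close>
      carries this back to the restriction of \<open>f\<close>, whose constant term
      vanishes.\<close>
    then obtain w where "u f * w = 1" by (rule mps_invertible)
    then have "v (u f * w) = 1" by simp
    then have "restrict_vars d f * v w = 1" by (simp add: v.hom_mult v_u)
    then have "mps_nth (restrict_vars d f * v w) {#} = mps_nth 1 {#}" by simp
    then show False using order_geD[OF f, of "{#}"] by (simp add: mps_nth_restrict mps_nth_one)
  qed
  have var: "mps_var j \<in> order_ge 1" for j
    by (simp add: mps_var_eq_monom order_ge_def mps_nth_monom)
  show "u f \<in> order_ge k" if "f \<in> order_ge k"
    using that
  \<comment> \<open>Splitting off one variable at a time reduces the claim to order
    \<open>1\<close>, where the unit argument applies.\<close>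
  proof (induction k arbitrary: f)
    case (Suc k)
    obtain q where q: "restrict_vars d f = (\<Sum>j<d. mps_var j * q j)" "\<And>j. q j \<in> order_ge k"
      using sum_var_mult_decomposition[OF order_ge_restrict[OF Suc.prems] restrict_restrict] by blast
    have "u f = (\<Sum>j<d. u (mps_var j) * u (q j))"
      using u_restrict[of f] by (simp add: q(1) u.hom_sum u.hom_mult)
    moreover have "u (mps_var j) * u (q j) \<in> order_ge (Suc k)" for j
      using order_ge_mult[OF 1[OF var] Suc.IH[OF q(2)]] by simp
    ultimately show ?case by (simp add: order_ge_sum)
  qed simp
qed

section \<open>The linear part as an element of the semilinear group\<close>

definition residue_hom :: "('a::comm_ring_1 mps \<Rightarrow> 'a mps) \<Rightarrow> 'a \<Rightarrow> 'a" where
  "residue_hom u c = mps_nth (u (mps_const c)) {#}"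

text \<open>Column \<open>j\<close> is the linear part of the image of \<open>x_j\<close>, the same
  convention as in \<open>linear_form\<close>.\<close>

definition linear_mat :: "nat \<Rightarrow> ('a::comm_ring_1 mps \<Rightarrow> 'a mps) \<Rightarrow> 'a mat" where
  "linear_mat d u = mat d d (\<lambda>(i, j). mps_nth (u (mps_var j)) {#i#})"

lemma linear_mat_carrier [simp]: "linear_mat d u \<in> carrier_mat d d"
  by (simp add: linear_mat_def)

lemma linear_mat_dim [simp]: "dim_row (linear_mat d u) = d" "dim_col (linear_mat d u) = d"
  by (simp_all add: linear_mat_def)

lemma mps_nth_var: "mps_nth (mps_var i) M = (if M = {#i#} then 1 else 0)"
  by (simp add: mps_var_eq_monom mps_nth_monom)

lemma mps_const_inject: "mps_const a = mps_const b \<longleftrightarrow> a = b"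
  by (metis mps_nth_const)

lemma hom_part_const: "hom_part k (mps_const c) = (if k = 0 then mps_const c else 0)"
  by (rule mps_eqI) (auto simp: mps_nth_hom_part mps_nth_const)

lemma hom_part_var: "hom_part k (mps_var j) = (if k = 1 then mps_var j else 0)"
  by (rule mps_eqI) (auto simp: mps_nth_hom_part mps_var_eq_monom mps_nth_monom)

lemma restrict_const [simp]: "restrict_vars d (mps_const c) = mps_const c"
  by (rule mps_eqI) (auto simp: mps_nth_restrict mps_nth_const)

lemma restrict_var [simp]: "j < d \<Longrightarrow> restrict_vars d (mps_var j) = mps_var j"
  by (rule mps_eqI) (auto simp: mps_nth_restrict mps_var_eq_monom mps_nth_monom)

context filtered_endo
begin

lemma gr_const: "gr hom (mps_const c) = mps_const (residue_hom hom c)"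
  by (rule mps_eqI) (simp add: gr_def hom_part_const mps_nth_const residue_hom_def)

lemma mps_nth_gr_var:
  assumes "j < d"
  shows "mps_nth (gr hom (mps_var j)) M = (\<Sum>i<d. if M = {#i#} then linear_mat d hom $$ (i, j) else 0)"
proof (cases "\<exists>i<d. M = {#i#}")
  case True
  then obtain i where i: "i < d" "M = {#i#}" by blast
  then have "(\<Sum>i'<d. if M = {#i'#} then linear_mat d hom $$ (i', j) else 0)
      = (\<Sum>i'<d. if i' = i then linear_mat d hom $$ (i, j) else 0)"
    by (intro sum.cong) auto
  then show ?thesis
    using i assms by (simp add: gr_def hom_part_var linear_mat_def)
next
  case False
  have "mps_nth (gr hom (mps_var j)) M = 0"
  proof (cases "size M = 1")
    case True
    then obtain i where "M = {#i#}" by (metis size_1_singleton_mset)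
    with False have "\<not> set_mset M \<subseteq> {..<d}" by auto
    then show ?thesis
      using mps_nth_restrict[of d "hom (hom_part (size M) (mps_var j))" M]
      by (simp add: gr_def restrict_hom)
  qed (simp add: gr_def hom_part_var)
  moreover have "(\<Sum>i<d. if M = {#i#} then linear_mat d hom $$ (i, j) else 0) = 0"
    using False by (intro sum.neutral) auto
  ultimately show ?thesis by simp
qed

lemma gr_var:
  assumes "j < d"
  shows "gr hom (mps_var j) = (\<Sum>i<d. mps_const (linear_mat d hom $$ (i, j)) * mps_var i)"
  by (rule mps_eqI)
    (auto simp: mps_nth_gr_var[OF assms] mps_nth_var intro!: sum.cong)

lemma comm_ring_hom_residue_hom: "comm_ring_hom (residue_hom hom)"
  by unfold_locales
    (simp_all add: residue_hom_def mps_const_add mps_const_mult hom_add hom_mult mps_nth_one)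

end

text \<open>An automorphism need not send constants to constants, but its graded version does; so
  the claim is \<open>gr_comp\<close> read off on constants.\<close>

lemma residue_hom_comp:
  assumes "filtered_endo d u" "filtered_endo d v"
  shows "residue_hom (\<lambda>f. u (v f)) c = residue_hom u (residue_hom v c)"
proof -
  have "mps_const (residue_hom (\<lambda>f. u (v f)) c) = mps_const (residue_hom u (residue_hom v c))"
    using filtered_endo.gr_const[OF filtered_endo_comp[OF assms], of c]
    by (simp add: gr_comp[OF assms] filtered_endo.gr_const[OF assms(1)] filtered_endo.gr_const[OF assms(2)])
  then show ?thesis by (simp add: mps_const_inject)
qed

lemma residue_hom_restrict: "residue_hom (restrict_vars d) c = c"
  by (simp add: residue_hom_def mps_nth_const)

lemma linear_mat_restrict: "linear_mat d (restrict_vars d) = 1\<^sub>m d"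
  by (rule eq_matI) (auto simp: linear_mat_def mps_var_eq_monom mps_nth_monom mps_nth_restrict)

text \<open>\<open>gr u\<close> acts on the coefficients of \<open>gr v (mps_var j)\<close> through
  the residue map of \<open>u\<close>. This twist of the second factor is the multiplication of the
  semidirect product.\<close>

lemma linear_mat_comp:
  assumes "filtered_endo d u" "filtered_endo d v"
  shows "linear_mat d (\<lambda>f. u (v f)) = linear_mat d u * map_mat (residue_hom u) (linear_mat d v)"
proof (rule eq_matI)
  interpret u: filtered_endo d u by fact
  interpret v: filtered_endo d v by fact
  interpret gr: filtered_endo d "gr u" by (rule filtered_endo_gr) fact
  fix i j
  assume "i < dim_row (linear_mat d u * map_mat (residue_hom u) (linear_mat d v))"
    "j < dim_col (linear_mat d u * map_mat (residue_hom u) (linear_mat d v))"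
  then have ij: "i < d" "j < d" by auto
  have "linear_mat d (\<lambda>f. u (v f)) $$ (i, j) = mps_nth (gr (\<lambda>f. u (v f)) (mps_var j)) {#i#}"
    using ij by (simp add: linear_mat_def gr_def hom_part_var)
  also have "gr (\<lambda>f. u (v f)) (mps_var j)
      = (\<Sum>m<d. mps_const (residue_hom u (linear_mat d v $$ (m, j))) * gr u (mps_var m))"
    using ij by (simp add: gr_comp[OF assms] v.gr_var gr.hom_sum gr.hom_mult u.gr_const)
  also have "mps_nth \<dots> {#i#}
      = (\<Sum>m<d. residue_hom u (linear_mat d v $$ (m, j)) * linear_mat d u $$ (i, m))"
    using ij by (simp add: u.mps_nth_gr_var)
  finally show "linear_mat d (\<lambda>f. u (v f)) $$ (i, j)
      = (linear_mat d u * map_mat (residue_hom u) (linear_mat d v)) $$ (i, j)"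
    using ij by (simp add: scalar_prod_def lessThan_atLeast0 mult.commute)
qed auto

text \<open>The inverse is the matrix of \<open>v\<close> twisted by the residue map of
  \<open>u\<close>. One product is the composition law for \<open>u\<close> after \<open>v\<close>;
  the other is the law for \<open>v\<close> after \<open>u\<close> with that residue map applied to
  it.\<close>

lemma linear_mat_in_GL:
  fixes u v :: "'a::field mps \<Rightarrow> 'a mps"
  assumes "filtered_iso d u v"
  shows "linear_mat d u \<in> carrier (GL d)"
proof -
  note D = filtered_isoD[OF assms]
  interpret r: comm_ring_hom "residue_hom u" by (rule filtered_endo.comm_ring_hom_residue_hom[OF D(1)])
  have uv: "(\<lambda>f. u (v f)) = restrict_vars d" and vu: "(\<lambda>f. v (u f)) = restrict_vars d"
    by (simp_all add: D fun_eq_iff)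
  let ?A = "linear_mat d u" and ?B = "map_mat (residue_hom u) (linear_mat d v)"
  have AB: "?A * ?B = 1\<^sub>m d"
    using linear_mat_comp[OF D(1,2)] by (simp add: uv linear_mat_restrict)
  have "?A = map_mat (residue_hom u) (map_mat (residue_hom v) ?A)"
    using residue_hom_comp[OF D(1,2)] by (intro eq_matI) (simp_all add: uv residue_hom_restrict)
  then have "?B * ?A = map_mat (residue_hom u) (linear_mat d v * map_mat (residue_hom v) ?A)"
    by (simp add: r.mat_hom_mult[of _ d d _ d])
  also have "linear_mat d v * map_mat (residue_hom v) ?A = 1\<^sub>m d"
    using linear_mat_comp[OF D(2,1), symmetric] by (simp add: vu linear_mat_restrict)
  also have "map_mat (residue_hom u) (1\<^sub>m d) = 1\<^sub>m d"
    by (rule r.mat_hom_one)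
  finally have "?B * ?A = 1\<^sub>m d" .
  with AB show ?thesis
    by (auto simp: GL_def units_of_def Units_def ring_mat_def intro!: bexI[of _ ?B])
qed

section \<open>Comparison with the semilinear action and the ring with explicit carrier\<close>

lemma mps_nth_power: "mps_nth (f ^ n) = mps_nth f [^]\<^bsub>power_series d\<^esub> n"
  by (induction n)
    (simp_all add: mps_nth_one_eq_one[of d] mps_nth_mult_eq_mult[of _ _ d] power_Suc2 del: power_Suc)

lemma mps_nth_prod:
  fixes f :: "'i \<Rightarrow> 'a::comm_ring_1 mps"
  assumes "finite I" "\<And>i. i \<in> I \<Longrightarrow> restrict_vars d (f i) = f i"
  shows "mps_nth (\<Prod>i\<in>I. f i) = (\<Otimes>\<^bsub>power_series d\<^esub> i\<in>I. mps_nth (f i))"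
proof -
  interpret cring "power_series d :: (nat multiset \<Rightarrow> 'a) ring" by (rule power_series_cring)
  show ?thesis
    using assms
  proof (induction I)
    case (insert i I)
    then have "mps_nth (f i) \<in> carrier (power_series d)" "\<And>j. j \<in> I \<Longrightarrow> mps_nth (f j) \<in> carrier (power_series d)"
      by (auto simp flip: restrict_eq_iff)
    with insert show ?case
      by (simp add: mps_nth_mult_eq_mult[of _ _ d])
  qed (simp add: mps_nth_one_eq_one[of d])
qed

text \<open>The coefficient at \<open>N\<close> depends only on the part of \<open>f\<close> of
  degree \<open>size N\<close>. This is a polynomial, on which \<open>gr u\<close> is determined by
  its values on constants and variables.\<close>

lemma semilinear_act_eq_gr:
  fixes u :: "'a::field mps \<Rightarrow> 'a mps"
  assumes u: "filtered_endo d u" and f: "restrict_vars d f = f"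
  shows "semilinear_act d (linear_mat d u, residue_hom u) (mps_nth f) = mps_nth (gr u f)"
proof
  fix N
  interpret u: filtered_endo d u by fact
  interpret gr: filtered_endo d "gr u" by (rule filtered_endo_gr) fact
  let ?S = "power_series d :: (nat multiset \<Rightarrow> 'a) ring"
  have var: "mps_nth (gr u (mps_var j)) = linear_form d (linear_mat d u) j" if "j < d" for j
    using that by (simp add: fun_eq_iff u.mps_nth_gr_var linear_form_eq)
  have mps_monom: "mps_nth (gr u (mps_monom M))
      = (\<Otimes>\<^bsub>?S\<^esub> j\<in>{..<d}. linear_form d (linear_mat d u) j [^]\<^bsub>?S\<^esub> count M j)"
    if "set_mset M \<subseteq> {..<d}" for M
  proof -
    interpret cring ?S by (rule power_series_cring)
    have "gr u (mps_monom M) = (\<Prod>j<d. gr u (mps_var j) ^ count M j)"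
      using that by (simp add: mps_monom_eq_prod_var gr.hom_prod gr.hom_power)
    then have "mps_nth (gr u (mps_monom M)) = (\<Otimes>\<^bsub>?S\<^esub> j\<in>{..<d}. mps_nth (gr u (mps_var j) ^ count M j))"
      using gr.restrict_hom by (simp add: mps_nth_prod flip: gr.hom_power)
    also have "\<dots> = (\<Otimes>\<^bsub>?S\<^esub> j\<in>{..<d}. linear_form d (linear_mat d u) j [^]\<^bsub>?S\<^esub> count M j)"
      by (rule finprod_cong') (auto simp: mps_nth_power[of _ _ d] var linear_form_closed)
    finally show ?thesis .
  qed
  have "mps_nth (gr u f) N = mps_nth (gr u (hom_part (size N) f)) N"
    by (simp add: gr_def hom_part_hom_part)
  also have "gr u (hom_part (size N) f) = (\<Sum>M\<in>multisets_of_size {..<d} (size N).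
      mps_const (residue_hom u (mps_nth f M)) * gr u (mps_monom M))"
    by (simp add: hom_part_eq_sum_monom[OF f] gr.hom_sum gr.hom_mult u.gr_const)
  also have "mps_nth \<dots> N = semilinear_act d (linear_mat d u, residue_hom u) (mps_nth f) N"
    by (auto simp: semilinear_act_def mps_monom multisets_of_size_def intro!: sum.cong)
  finally show "semilinear_act d (linear_mat d u, residue_hom u) (mps_nth f) N = mps_nth (gr u f) N"
    by simp
qed

text \<open>Restricting first ensures that \<open>h\<close> is evaluated only on the carrier; its
  values elsewhere are arbitrary.\<close>

definition mps_map :: "nat \<Rightarrow> ((nat multiset \<Rightarrow> 'a) \<Rightarrow> nat multiset \<Rightarrow> 'a) \<Rightarrow> 'a::comm_ring_1 mps \<Rightarrow> 'a mps" where
  "mps_map d h f = Abs_mps (h (mps_nth (restrict_vars d f)))"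

lemma mps_map_restrict: "mps_map d h (restrict_vars d f) = mps_map d h f"
  by (simp add: mps_map_def)

lemma restrict_mps_map:
  assumes "h \<in> ring_iso (power_series d) (power_series d)"
  shows "restrict_vars d (mps_map d h f) = mps_map d h f"
  using ring_iso_memE(1)[OF assms mps_nth_restrict_carrier] by (simp add: mps_map_def restrict_eq_iff)

lemma comm_ring_hom_mps_map:
  assumes h: "h \<in> ring_iso (power_series d) (power_series d)"
  shows "comm_ring_hom (mps_map d h)"
proof -
  have add: "mps_map d h (f + g) = mps_map d h f + mps_map d h g" for f g
    using ring_iso_memE(3)[OF h mps_nth_restrict_carrier mps_nth_restrict_carrier, of f g]
    by (intro iffD1[OF mps_nth_inject]) (simp only: mps_map_def restrict_add mps_nth_add_eq_add[of _ _ d] mps_nth_Abs)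
  moreover have "mps_map d h (f * g) = mps_map d h f * mps_map d h g" for f g
    using ring_iso_memE(2)[OF h mps_nth_restrict_carrier mps_nth_restrict_carrier, of f g]
    by (intro iffD1[OF mps_nth_inject]) (simp only: mps_map_def restrict_mult mps_nth_mult_eq_mult[of _ _ d] mps_nth_Abs)
  moreover have "mps_map d h 1 = 1"
    using ring_iso_memE(4)[OF h]
    by (intro iffD1[OF mps_nth_inject]) (simp only: mps_map_def restrict_one mps_nth_one_eq_one[of d] mps_nth_Abs)
  moreover have "mps_map d h 0 = 0" using add[of 0 0] by simp
  ultimately show ?thesis by unfold_locales
qed

text \<open>Preservation of the filtration is automatic: the inverse element of the group supplies
  the inverse automorphism required by \<open>ring_automorphism_filtered\<close>.\<close>

lemma filtered_action_mps_map:
  fixes G :: "('g, 'm) monoid_scheme" and \<rho> :: "'g \<Rightarrow> (nat multiset \<Rightarrow> 'l::field) \<Rightarrow> nat multiset \<Rightarrow> 'l"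
  assumes "group_action G (carrier (power_series d)) \<rho>"
    and hom: "\<And>g. g \<in> carrier G \<Longrightarrow> \<rho> g \<in> ring_iso (power_series d) (power_series d)"
  shows "filtered_action G d (\<lambda>g. mps_map d (\<rho> g))"
proof -
  interpret group_action G "carrier (power_series d)" \<rho> by fact
  interpret group G by (rule group_hom.axioms(1)[OF group_hom])
  have mult: "mps_map d (\<rho> (g \<otimes>\<^bsub>G\<^esub> h)) f = mps_map d (\<rho> g) (mps_map d (\<rho> h) f)"
    if "g \<in> carrier G" "h \<in> carrier G" for g h f
    using restrict_mps_map[OF hom[OF that(2)], of f] that
    by (subst (2) mps_map_def) (simp add: mps_map_def composition_rule mps_nth_restrict_carrier)
  have one: "mps_map d (\<rho> \<one>\<^bsub>G\<^esub>) f = restrict_vars d f" for f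
    by (simp add: mps_map_def mps_nth_restrict_carrier mps_nth_inverse flip: id_eq_one)
  have "filtered_endo d (mps_map d (\<rho> g))" if g: "g \<in> carrier G" for g
  proof -
    have g': "inv\<^bsub>G\<^esub> g \<in> carrier G" using g by simp
    have "mps_map d (\<rho> (inv\<^bsub>G\<^esub> g)) (mps_map d (\<rho> g) f) = restrict_vars d f" for f
      using g g' by (simp add: one flip: mult)
    from ring_automorphism_filtered[OF comm_ring_hom_mps_map[OF hom[OF g]]
        comm_ring_hom_mps_map[OF hom[OF g']] mps_map_restrict this]
    have "\<And>f k. f \<in> order_ge k \<Longrightarrow> mps_map d (\<rho> g) f \<in> order_ge k" .
    then show ?thesis
      by (intro filtered_endo.intro comm_ring_hom_mps_map hom filtered_endo_axioms.intro
          mps_map_restrict restrict_mps_map g)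
  qed
  then show ?thesis
    by (intro filtered_action.intro filtered_action_axioms.intro group_axioms) (auto simp: mult one)
qed

lemma ring_iso_invariant_ring:
  fixes R :: "('r, 'm) ring_scheme" and S :: "('s, 'n) ring_scheme"
  assumes h: "h \<in> ring_iso R S"
    and eq: "\<And>x. x \<in> carrier R \<Longrightarrow> (\<forall>g\<in>X. a g x = x) \<longleftrightarrow> (\<forall>g\<in>Y. b g (h x) = h x)"
  shows "h \<in> ring_iso (invariant_ring R a X) (invariant_ring S b Y)"
proof (rule ring_iso_memI)
  have bij: "bij_betw h (carrier R) (carrier S)" by (rule ring_iso_memE(5)[OF h])
  then have S: "carrier S = h ` carrier R" by (simp add: bij_betw_def)
  have "h ` {f \<in> carrier R. \<forall>g\<in>X. a g f = f} = {f \<in> carrier S. \<forall>g\<in>Y. b g f = f}"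
    unfolding S using eq by blast
  then show "bij_betw h (carrier (invariant_ring R a X)) (carrier (invariant_ring S b Y))"
    using bij by (auto simp: invariant_ring_def bij_betw_def intro: inj_on_subset)
qed (use h eq in \<open>auto simp: invariant_ring_def ring_iso_memE\<close>)

lemma ring_iso_of_filtered_iso:
  assumes "filtered_iso d u v"
  shows "(\<lambda>f. mps_nth (u (Abs_mps f))) \<in> ring_iso (power_series d) (power_series d)"
proof -
  note D = filtered_isoD[OF assms]
  interpret u: filtered_endo d u by (rule D)
  interpret v: filtered_endo d v by (rule D)
  let ?S = "power_series d :: (nat multiset \<Rightarrow> 'a) ring"
  have Abs: "Abs_mps (f \<otimes>\<^bsub>?S\<^esub> g) = Abs_mps f * Abs_mps g"
    "Abs_mps (f \<oplus>\<^bsub>?S\<^esub> g) = Abs_mps f + Abs_mps g"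
    "Abs_mps \<one>\<^bsub>?S\<^esub> = 1" for f g
    by (simp_all add: mps_nth_mult_eq_mult[of _ _ d] mps_nth_add_eq_add[of _ _ d]
        mps_nth_one_eq_one[of d] flip: mps_nth_inject)
  have restrict_vars: "restrict_vars d (Abs_mps f) = Abs_mps f" if "f \<in> carrier ?S" for f
    using that by (simp add: restrict_eq_iff)
  have closed: "mps_nth (u f) \<in> carrier ?S" "mps_nth (v f) \<in> carrier ?S" for f
    by (simp_all add: u.restrict_hom v.restrict_hom flip: restrict_eq_iff)
  have "bij_betw (\<lambda>f. mps_nth (u (Abs_mps f))) (carrier ?S) (carrier ?S)"
    by (rule bij_betw_byWitness[where f' = "\<lambda>f. mps_nth (v (Abs_mps f))"])
      (auto simp: D restrict_vars closed mps_nth_inverse)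
  then show ?thesis
    by (intro ring_iso_memI)
      (simp_all add: closed Abs u.hom_mult u.hom_add mps_nth_mult_eq_mult[of _ _ d]
        mps_nth_add_eq_add[of _ _ d] mps_nth_one_eq_one[of d])
qed

section \<open>The semilinear form of the action and the isomorphism of invariant rings\<close>

theorem proposition0p8:
  fixes d :: nat
    and G :: "('g, 'm) monoid_scheme"
    and \<rho> :: "'g \<Rightarrow> (nat multiset \<Rightarrow> 'l::field) \<Rightarrow> nat multiset \<Rightarrow> 'l"
  assumes "group G"
    and "finite (carrier G)"
    and "group_action G (carrier (power_series d)) \<rho>"
    and "\<And>g. g \<in> carrier G \<Longrightarrow> \<rho> g \<in> ring_iso (power_series d) (power_series d)"
    and "\<not> CHAR('l) dvd card (carrier G)"
  shows "\<exists>\<phi> \<theta>.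
    \<phi> \<in> hom G (semilinear_group d (residue_fixed_field G \<rho>)) \<and>
    \<theta> \<in> ring_iso (power_series d) (power_series d) \<and>
    (\<forall>g\<in>carrier G. \<forall>f\<in>carrier (power_series d).
       \<rho> g (\<theta> f) = \<theta> (semilinear_act d (\<phi> g) f)) \<and>
    invariant_ring (power_series d) \<rho> (carrier G)
      \<simeq> invariant_ring (power_series d) (semilinear_act d) (\<phi> ` carrier G)"
proof -
  let ?S = "power_series d :: (nat multiset \<Rightarrow> 'l) ring"
  define \<alpha> where "\<alpha> g = mps_map d (\<rho> g)" for g
  interpret \<alpha>: filtered_action G d \<alpha>
    unfolding \<alpha>_def by (rule filtered_action_mps_map[OF assms(3,4)])
  \<comment> \<open>The divisibility hypothesis says exactly that \<open>|G|\<close> is nonzero in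
    the field, in characteristic zero as well.\<close>
  have card: "inverse (of_nat (card (carrier G))) * of_nat (card (carrier G)) = (1 :: 'l)"
    using assms(5) by (simp add: of_nat_eq_0_iff_char_dvd)
  obtain \<theta> \<theta>' where iso: "filtered_iso d \<theta> \<theta>'"
    and conj: "\<And>g f. g \<in> carrier G \<Longrightarrow> \<alpha> g (\<theta> f) = \<theta> (gr (\<alpha> g) f)"
    using filtered_actions_conjugate[OF \<alpha>.filtered_action_axioms
        filtered_action_gr[OF \<alpha>.filtered_action_axioms] assms(2) card
        acts_agree_gr[OF \<alpha>.filtered_action_axioms]] by blast
  note D = filtered_isoD[OF iso]
  define \<phi> where "\<phi> g = (linear_mat d (\<alpha> g), residue_hom (\<alpha> g))" for g
  define \<Theta> where "\<Theta> f = mps_nth (\<theta> (Abs_mps f))" for f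
  define \<Theta>' where "\<Theta>' f = mps_nth (\<theta>' (Abs_mps f))" for f
  have comp: "\<alpha> (g \<otimes>\<^bsub>G\<^esub> h) = (\<lambda>f. \<alpha> g (\<alpha> h f))" if "g \<in> carrier G" "h \<in> carrier G" for g h
    using that by (simp add: fun_eq_iff \<alpha>.act_mult)
  have residue: "residue_hom (\<alpha> g) = residue_map (\<rho> g)" for g
    by (simp add: fun_eq_iff residue_hom_def residue_map_def \<alpha>_def mps_map_def mps_const.rep_eq)
  \<comment> \<open>The residue map of the inverse group element is the inverse map.\<close>
  have bij: "bij (residue_hom (\<alpha> g))" if g: "g \<in> carrier G" for g
  proof (rule o_bij)
    have "residue_hom (\<alpha> h) (residue_hom (\<alpha> (inv\<^bsub>G\<^esub> h)) c) = c" if "h \<in> carrier G" for h c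
    proof -
      have "(\<lambda>f. \<alpha> h (\<alpha> (inv\<^bsub>G\<^esub> h) f)) = restrict_vars d"
        using filtered_isoD(3)[OF \<alpha>.act_iso[OF that]] by (simp add: fun_eq_iff)
      then show ?thesis
        using that residue_hom_comp[OF \<alpha>.endo \<alpha>.endo, of h "inv\<^bsub>G\<^esub> h" c]
        by (simp add: residue_hom_restrict)
    qed
    from this[OF g] this[of "inv\<^bsub>G\<^esub> g"] g
    show "residue_hom (\<alpha> (inv\<^bsub>G\<^esub> g)) \<circ> residue_hom (\<alpha> g) = id"
      "residue_hom (\<alpha> g) \<circ> residue_hom (\<alpha> (inv\<^bsub>G\<^esub> g)) = id"
      by (simp_all add: fun_eq_iff)
  qed
  have "\<phi> g \<in> carrier (semilinear_group d (residue_fixed_field G \<rho>))" if g: "g \<in> carrier G" for g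
  proof -
    interpret comm_ring_hom "residue_hom (\<alpha> g)"
      by (rule filtered_endo.comm_ring_hom_residue_hom[OF \<alpha>.endo[OF g]])
    have "field_hom (residue_hom (\<alpha> g))" by unfold_locales
    then show ?thesis
      using bij[OF g] linear_mat_in_GL[OF \<alpha>.act_iso[OF g]] g
      by (auto simp: \<phi>_def semilinear_group_def semidirect_product_def Gal_def
          residue_fixed_field_def residue)
  qed
  then have \<phi>: "\<phi> \<in> hom G (semilinear_group d (residue_fixed_field G \<rho>))"
    by (auto simp: hom_def \<phi>_def comp linear_mat_comp[OF \<alpha>.endo \<alpha>.endo]
        residue_hom_comp[OF \<alpha>.endo \<alpha>.endo] fun_eq_iff
        semilinear_group_def semidirect_product_def Gal_def GL_def units_of_def ring_mat_def)
  have \<Theta>: "\<Theta> \<in> ring_iso ?S ?S"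
    unfolding \<Theta>_def by (rule ring_iso_of_filtered_iso[OF iso])
  have "filtered_iso d \<theta>' \<theta>" using iso by (auto simp: filtered_iso_def)
  then have \<Theta>': "\<Theta>' \<in> ring_iso ?S ?S"
    unfolding \<Theta>'_def by (rule ring_iso_of_filtered_iso)
  have act: "Abs_mps (semilinear_act d (\<phi> g) f) = gr (\<alpha> g) (Abs_mps f)"
    if "g \<in> carrier G" "f \<in> carrier ?S" for g f
    using semilinear_act_eq_gr[OF \<alpha>.endo[OF that(1)], of "Abs_mps f"] that
    by (simp add: \<phi>_def restrict_eq_iff mps_nth_inverse)
  have conj': "\<rho> g (\<Theta> f) = \<Theta> (semilinear_act d (\<phi> g) f)"
    if "g \<in> carrier G" "f \<in> carrier ?S" for g f
    using conj[OF that(1), of "Abs_mps f"] filtered_endo.restrict_hom[OF D(1)]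
    by (simp add: \<Theta>_def act[OF that] \<alpha>_def mps_map_def flip: mps_nth_inject)
  \<comment> \<open>The inverse of \<open>\<Theta>\<close> goes from the \<open>G\<close>-invariants
    to the \<open>\<phi>(G)\<close>-invariants, since \<open>\<Theta>\<close> intertwines the two
    actions.\<close>
  have "\<Theta>' \<in> ring_iso (invariant_ring ?S \<rho> (carrier G))
      (invariant_ring ?S (semilinear_act d) (\<phi> ` carrier G))"
  proof (rule ring_iso_invariant_ring[OF \<Theta>'])
    fix f assume f: "f \<in> carrier ?S"
    have f': "\<Theta>' f \<in> carrier ?S" by (rule ring_iso_memE(1)[OF \<Theta>' f])
    have "restrict_vars d (Abs_mps f) = Abs_mps f"
      using f by (simp add: restrict_eq_iff)
    then have inv: "\<Theta> (\<Theta>' f) = f"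
      by (simp add: \<Theta>_def \<Theta>'_def mps_nth_inverse D)
    have "\<rho> g f = f \<longleftrightarrow> semilinear_act d (\<phi> g) (\<Theta>' f) = \<Theta>' f" if g: "g \<in> carrier G" for g
    proof -
      interpret gr: filtered_endo d "gr (\<alpha> g)" by (rule filtered_endo_gr[OF \<alpha>.endo[OF g]])
      \<comment> \<open>Membership is needed because \<open>\<Theta>\<close> is known to be
        injective only on the carrier.\<close>
      have "semilinear_act d (\<phi> g) (\<Theta>' f) \<in> carrier ?S"
        using act[OF g f'] gr.restrict_hom[of "Abs_mps (\<Theta>' f)"] by (metis restrict_eq_iff mps_nth_Abs)
      then have "\<Theta> (semilinear_act d (\<phi> g) (\<Theta>' f)) = \<Theta> (\<Theta>' f)
          \<longleftrightarrow> semilinear_act d (\<phi> g) (\<Theta>' f) = \<Theta>' f"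
        using ring_iso_memE(5)[OF \<Theta>] f' by (auto simp: bij_betw_def inj_on_eq_iff)
      then show ?thesis
        using conj'[OF g f'] by (simp add: inv)
    qed
    then show "(\<forall>g\<in>carrier G. \<rho> g f = f)
        \<longleftrightarrow> (\<forall>y\<in>\<phi> ` carrier G. semilinear_act d y (\<Theta>' f) = \<Theta>' f)"
      by auto
  qed
  then show ?thesis
    using \<phi> \<Theta> conj' unfolding is_ring_iso_def by blast
qed

end
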